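(* For every $K\in\mathbb{N}^*$ with $K\ge2$ and every $n\in\mathbb{N}^*$, there exists a real-valued $\mu\in C_c^\infty(0,1)$ satisfying (H1)$_K$ and (H2)$_{K,n}$.
   Context: $\varphi_j=\sqrt2\sin(j\pi x)$, $\lambda_j=(j\pi)^2$, $\langle f,g\rangle=\int_0^1f\bar g$. (H1)$_K$: $\langle\mu\varphi_1,\varphi_K\rangle=0$. (H2)$_{K,n}$: with $c_j=\langle\mu\varphi_1,\varphi_j\rangle\langle\mu\varphi_K,\varphi_j\rangle$, $\sum_jj^{4n}|c_j|<\infty$, and with $A^p_K=(-1)^{p-1}\sum_{j}(\lambda_j-\frac{\lambda_1+\lambda_K}2)(\lambda_K-\lambda_j)^{p-1}(\lambda_j-\lambda_1)^{p-1}c_j$, $A^p_K=0$ for $1\le p\le n-1$ and $A^n_K\ne0$. *)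

theory Defs
  imports "HOL-Analysis.Analysis"
begin

text \<open>Dirichlet eigenfunctions and eigenvalues on (0,1).\<close>
definition phi :: "nat \<Rightarrow> real \<Rightarrow> real" where
  "phi j x = sqrt 2 * sin (real j * pi * x)"

definition lam :: "nat \<Rightarrow> real" where
  "lam j = (real j * pi)\<^sup>2"

text \<open>L^2(0,1) inner product (real-valued functions, so no conjugation needed).\<close>
definition ip :: "(real \<Rightarrow> real) \<Rightarrow> (real \<Rightarrow> real) \<Rightarrow> real" where
  "ip f g = integral {0..1} (\<lambda>x. f x * g x)"

definition smooth_compact_01 :: "(real \<Rightarrow> real) \<Rightarrow> bool" where
  "smooth_compact_01 mu \<longleftrightarrow>
     (\<forall>k x. ((deriv ^^ k) mu) differentiable (at x)) \<and>
     (\<exists>a b. 0 < a \<and> a \<le> b \<and> b < 1 \<and> (\<forall>x. x \<notin> {a..b} \<longrightarrow> mu x = 0))"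

definition cc :: "(real \<Rightarrow> real) \<Rightarrow> nat \<Rightarrow> nat \<Rightarrow> real" where
  "cc mu K j = ip (\<lambda>x. mu x * phi 1 x) (phi j) * ip (\<lambda>x. mu x * phi K x) (phi j)"

definition H1 :: "(real \<Rightarrow> real) \<Rightarrow> nat \<Rightarrow> bool" where
  "H1 mu K \<longleftrightarrow> ip (\<lambda>x. mu x * phi 1 x) (phi K) = 0"

definition AKp :: "(real \<Rightarrow> real) \<Rightarrow> nat \<Rightarrow> nat \<Rightarrow> real" where
  "AKp mu K p = (-1) ^ (p - 1) *
     (\<Sum>i. let j = Suc i in
        (lam j - (lam 1 + lam K) / 2) * (lam K - lam j) ^ (p - 1) * (lam j - lam 1) ^ (p - 1)
        * cc mu K j)"

definition H2 :: "(real \<Rightarrow> real) \<Rightarrow> nat \<Rightarrow> nat \<Rightarrow> bool" where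
  "H2 mu K n \<longleftrightarrow>
     summable (\<lambda>i. real (Suc i) ^ (4 * n) * \<bar>cc mu K (Suc i)\<bar>) \<and>
     (\<forall>p. 1 \<le> p \<and> p \<le> n - 1 \<longrightarrow> AKp mu K p = 0) \<and>
     AKp mu K n \<noteq> 0"

end

theory Submission
  imports Defs "HOL-Computational_Algebra.Polynomial"
begin

text \<open>
  Write $L_a f = -f'' - a f$, so that $\langle L_a h, \varphi_j\rangle = (\lambda_j - a)\langle h, \varphi_j\rangle$
  for test functions $h$, and take $\mu = L_{\lambda_K} h / \varphi_1$: then (H1) is automatic. By Parseval,
  $A^p_K = Q_p(h) = \int (L_m (L_{\lambda_K} L_{\lambda_1})^{p-1} f) f w$ with $f = L_{\lambda_K} h$,
  $m = (\lambda_1 + \lambda_K)/2$ and $w = \varphi_K / \varphi_1$.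
  These quadratic forms are local, hence additive on functions with disjoint supports. On a bump of
  width $\varepsilon$ at $x_0$, $Q_p$ behaves like $\varepsilon^{-4p-1} w(x_0)$ times a positive constant,
  so the ratios $Q_{p+1}/Q_p$ are arbitrarily large, and $w$ takes both signs. Inductively, adding a
  fixed function with $Q_n < 0$ and a much more concentrated one with $Q_n > 0$, normalised so
  that $Q_n$ cancels, yields functions with $Q_1 = \dots = Q_n = 0$, $Q_{n+1}$ of a prescribed
  sign, and again arbitrarily large successive ratios.
\<close>

section \<open>Smooth functions on the real line\<close>

text \<open>This repeats the first clause of \<open>smooth_compact_01\<close>, so that clause
  follows by unfolding once \<open>mu\<close> is known to be smooth.\<close>

definition smooth :: "(real \<Rightarrow> real) \<Rightarrow> bool" where
  "smooth f \<longleftrightarrow> (\<forall>k x. ((deriv ^^ k) f) differentiable (at x))"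

definition vanishes_off :: "real set \<Rightarrow> (real \<Rightarrow> real) \<Rightarrow> bool" where
  "vanishes_off S f \<longleftrightarrow> (\<forall>x. x \<notin> S \<longrightarrow> f x = 0)"

text \<open>Iterated derivatives never leave a class that is closed under differentiation, so no
  formula for a k-th derivative is needed. The closure results below only have to name a suitable
  class.\<close>

lemma smooth_coinduct:
  assumes "f \<in> S" and "\<And>g. g \<in> S \<Longrightarrow> \<exists>g'\<in>S. \<forall>x. (g has_real_derivative g' x) (at x)"
  shows "smooth f"
proof -
  have "(deriv ^^ k) f \<in> S" for k
  proof (induction k)
    case (Suc k)
    then obtain g' where g': "g' \<in> S" "\<forall>x. ((deriv ^^ k) f has_real_derivative g' x) (at x)"
      using assms(2) by blast
    then have "deriv ((deriv ^^ k) f) = g'"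
      by (auto intro: DERIV_imp_deriv)
    then show ?case using g' by simp
  qed (use assms in simp)
  then show ?thesis
    unfolding smooth_def using assms(2) real_differentiable_def by blast
qed

lemma smooth_DERIV:
  assumes "smooth f" shows "(f has_real_derivative deriv f x) (at x)"
proof -
  have "(deriv ^^ 0) f differentiable (at x)"
    using assms unfolding smooth_def by blast
  then show ?thesis by (simp add: DERIV_deriv_iff_real_differentiable)
qed

lemma smooth_DERIV_chain:
  assumes "smooth f" and "(g has_real_derivative g') (at x within S)"
  shows "((\<lambda>x. f (g x)) has_real_derivative deriv f (g x) * g') (at x within S)"
  using DERIV_chain2[OF smooth_DERIV[OF assms(1)] assms(2)] .

lemma smooth_funpow_deriv: "smooth f \<Longrightarrow> smooth ((deriv ^^ k) f)"
  unfolding smooth_def by (metis comp_apply funpow_add)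

lemma smooth_deriv: "smooth f \<Longrightarrow> smooth (deriv f)"
  using smooth_funpow_deriv[of f 1] by simp

lemma smooth_continuous_on: "smooth f \<Longrightarrow> continuous_on S f"
  by (meson DERIV_continuous_on smooth_DERIV has_field_derivative_at_within)

lemma smooth_add:
  assumes "smooth f" "smooth g" shows "smooth (\<lambda>x. f x + g x)"
proof (rule smooth_coinduct[where S = "{\<lambda>x. f x + g x |f g. smooth f \<and> smooth g}"])
  fix h assume "h \<in> {\<lambda>x. f x + g x |f g. smooth f \<and> smooth g}"
  then obtain f g where h: "h = (\<lambda>x. f x + g x)" "smooth f" "smooth g" by blast
  then have "(h has_real_derivative deriv f x + deriv g x) (at x)" for x
    by (auto intro!: derivative_eq_intros smooth_DERIV)
  moreover have "(\<lambda>x. deriv f x + deriv g x) \<in> {\<lambda>x. f x + g x |f g. smooth f \<and> smooth g}"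
    using h smooth_deriv by blast
  ultimately show "\<exists>g'\<in>{\<lambda>x. f x + g x |f g. smooth f \<and> smooth g}. \<forall>x. (h has_real_derivative g' x) (at x)"
    by (intro bexI) auto
qed (use assms in blast)

text \<open>By the Leibniz rule single products are not closed under differentiation, but their
  finite sums are.\<close>

inductive_set product_sums :: "(real \<Rightarrow> real) set" where
  prod: "smooth f \<Longrightarrow> smooth g \<Longrightarrow> (\<lambda>x. f x * g x) \<in> product_sums"
| sum: "f \<in> product_sums \<Longrightarrow> g \<in> product_sums \<Longrightarrow> (\<lambda>x. f x + g x) \<in> product_sums"

lemma smooth_mult:
  assumes "smooth f" "smooth g" shows "smooth (\<lambda>x. f x * g x)"
proof (rule smooth_coinduct[where S = product_sums])
  fix h assume "h \<in> product_sums"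
  then show "\<exists>h'\<in>product_sums. \<forall>x. (h has_real_derivative h' x) (at x)"
  proof induction
    case (prod f g)
    have "((\<lambda>x. f x * g x) has_real_derivative deriv f x * g x + f x * deriv g x) (at x)" for x
      using prod by (auto intro!: derivative_eq_intros smooth_DERIV)
    moreover have "(\<lambda>x. deriv f x * g x + f x * deriv g x) \<in> product_sums"
      using prod by (intro product_sums.intros smooth_deriv)
    ultimately show ?case by (intro bexI) auto
  next
    case (sum f g)
    then obtain f' g' where d: "f' \<in> product_sums" "g' \<in> product_sums"
      "\<forall>x. (f has_real_derivative f' x) (at x)" "\<forall>x. (g has_real_derivative g' x) (at x)" by blast
    then have "((\<lambda>x. f x + g x) has_real_derivative f' x + g' x) (at x)" for x
      by (auto intro!: derivative_eq_intros)
    then show ?case using d product_sums.sum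
      by (intro bexI[of _ "\<lambda>x. f' x + g' x"]) auto
  qed
qed (use assms in \<open>rule product_sums.prod\<close>)

lemma smooth_const: "smooth (\<lambda>x. c)"
  by (rule smooth_coinduct[where S = "range (\<lambda>c x. c)"]) (auto intro!: exI[of _ 0])

lemma smooth_cmult: "smooth f \<Longrightarrow> smooth (\<lambda>x. c * f x)"
  by (intro smooth_mult smooth_const)

text \<open>The chain rule produces powers of \<open>a\<close>, so the invariant class allows an
  arbitrary scalar in front.\<close>

lemma smooth_affine:
  assumes "smooth f" shows "smooth (\<lambda>x. f (a * x + b))"
proof (rule smooth_coinduct[where S = "{\<lambda>x. c * f (a * x + b) |c f. smooth f}"])
  show "(\<lambda>x. f (a * x + b)) \<in> {\<lambda>x. c * f (a * x + b) |c f. smooth f}"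
    using assms by (auto intro!: exI[of _ 1] exI[of _ f])
  fix h assume "h \<in> {\<lambda>x. c * f (a * x + b) |c f. smooth f}"
  then obtain c f where h: "h = (\<lambda>x. c * f (a * x + b))" "smooth f" by blast
  then have "(h has_real_derivative (c * a) * deriv f (a * x + b)) (at x)" for x
    by (auto intro!: derivative_eq_intros smooth_DERIV_chain)
  moreover have "(\<lambda>x. (c * a) * deriv f (a * x + b)) \<in> {\<lambda>x. c * f (a * x + b) |c f. smooth f}"
    using h smooth_deriv by blast
  ultimately show "\<exists>h'\<in>{\<lambda>x. c * f (a * x + b) |c f. smooth f}. \<forall>x. (h has_real_derivative h' x) (at x)"
    by (intro bexI) auto
qed

text \<open>Differentiating a sine shifts its phase by pi/2; with a free phase the class closes
  without mentioning cosines.\<close>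

lemma smooth_sin: "smooth (\<lambda>x. c * sin (a * x))"
proof (rule smooth_coinduct[where S = "{\<lambda>x. c * sin (a * x + b) |c b. True}"])
  show "(\<lambda>x. c * sin (a * x)) \<in> {\<lambda>x. c * sin (a * x + b) |c b. True}"
    by (rule CollectI, intro exI[of _ c] exI[of _ 0]) simp
  fix h assume "h \<in> {\<lambda>x. c * sin (a * x + b) |c b. True}"
  then obtain c b where h: "h = (\<lambda>x. c * sin (a * x + b))" by blast
  have "(h has_real_derivative (c * a) * sin (a * x + (b + pi / 2))) (at x)" for x
    unfolding h by (auto intro!: derivative_eq_intros simp: sin_add cos_add algebra_simps)
  then show "\<exists>h'\<in>{\<lambda>x. c * sin (a * x + b) |c b. True}. \<forall>x. (h has_real_derivative h' x) (at x)"
    by (intro bexI[of _ "\<lambda>x. (c * a) * sin (a * x + (b + pi / 2))"]) auto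
qed

lemma vanishes_off_deriv:
  assumes "closed S" "vanishes_off S f" shows "vanishes_off S (deriv f)"
  unfolding vanishes_off_def
proof (intro allI impI)
  fix x assume "x \<notin> S"
  have "(f has_real_derivative 0) (at x)"
    by (rule has_field_derivative_transform_within_open[where f = "\<lambda>_. 0" and S = "-S"])
       (use assms \<open>x \<notin> S\<close> in \<open>auto simp: vanishes_off_def\<close>)
  then show "deriv f x = 0" by (rule DERIV_imp_deriv)
qed

text \<open>On \<open>S\<close> the quotient rule applies. Off \<open>S\<close> the numerator
  vanishes on an open set, so the quotient is locally 0 even at zeros of \<open>g\<close>. The class
  of all f / g^k is closed because the derivative is (f' g - k f g') / g^(k+1), whose numerator
  again vanishes off \<open>S\<close>.\<close>

lemma smooth_divide:
  assumes f: "smooth f" "vanishes_off S f" and S: "closed S"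
    and g: "smooth g" "\<And>x. x \<in> S \<Longrightarrow> g x \<noteq> 0"
  shows "smooth (\<lambda>x. f x / g x)"
proof -
  define \<Q> where "\<Q> = {\<lambda>x. f x / g x ^ k |f k. smooth f \<and> vanishes_off S f}"
  show ?thesis
  proof (rule smooth_coinduct[where S = \<Q>])
    show "(\<lambda>x. f x / g x) \<in> \<Q>"
      unfolding \<Q>_def using f by (auto intro!: exI[of _ f] exI[of _ 1])
    fix h assume "h \<in> \<Q>"
    then obtain f k where h: "h = (\<lambda>x. f x / g x ^ k)" and f: "smooth f" "vanishes_off S f"
      unfolding \<Q>_def by blast
    define f' where "f' x = deriv f x * g x + (- real k) * (f x * deriv g x)" for x
    have "smooth f'"
      unfolding f'_def using f g by (intro smooth_add smooth_cmult smooth_mult smooth_deriv)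
    moreover have "vanishes_off S f'"
      using f vanishes_off_deriv[OF S f(2)] by (simp add: vanishes_off_def f'_def)
    ultimately have f': "smooth f'" "vanishes_off S f'" by blast+
    have "(h has_real_derivative f' x / g x ^ Suc k) (at x)" for x
    proof (cases "x \<in> S")
      case True
      then have "g x \<noteq> 0" by (rule g)
      then have "(h has_real_derivative
          (deriv f x * g x ^ k - f x * (real k * g x ^ (k - Suc 0) * deriv g x)) / (g x ^ k * g x ^ k)) (at x)"
        unfolding h using f g
        by (intro DERIV_divide smooth_DERIV DERIV_chain2[where f = "\<lambda>y. y ^ k", OF DERIV_pow]) simp_all
      also have "(deriv f x * g x ^ k - f x * (real k * g x ^ (k - Suc 0) * deriv g x)) / (g x ^ k * g x ^ k)
         = f' x / g x ^ Suc k"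
      \<comment> \<open>For \<open>k = 0\<close> the truncated exponent \<open>k - Suc 0\<close> is
        harmless because of the factor \<open>real k\<close>; otherwise a common power of
        \<open>g x\<close> cancels.\<close>
      proof (cases k)
        case (Suc l)
        have "(deriv f x * g x ^ k - f x * (real k * g x ^ (k - Suc 0) * deriv g x)) / (g x ^ k * g x ^ k)
          = (g x ^ l * f' x) / (g x ^ l * g x ^ Suc k)"
          unfolding Suc f'_def by (simp add: algebra_simps)
        then show ?thesis using \<open>g x \<noteq> 0\<close> by simp
      qed (use \<open>g x \<noteq> 0\<close> in \<open>simp add: f'_def\<close>)
      finally show ?thesis .
    next
      case False
      have "(h has_real_derivative 0) (at x)"
        by (rule has_field_derivative_transform_within_open[where f = "\<lambda>_. 0" and S = "-S"])
           (use False S f in \<open>auto simp: vanishes_off_def h\<close>)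
      then show ?thesis using f' False by (simp add: vanishes_off_def)
    qed
    moreover have "(\<lambda>x. f' x / g x ^ Suc k) \<in> \<Q>"
      unfolding \<Q>_def using f' by blast
    ultimately show "\<exists>h'\<in>\<Q>. \<forall>x. (h has_real_derivative h' x) (at x)" by (intro bexI) auto
  qed
qed

section \<open>A smooth bump built from exp(-1/x)\<close>

definition flat_exp :: "real poly \<Rightarrow> real \<Rightarrow> real" where
  "flat_exp p x = (if x > 0 then poly p (1 / x) * exp (- (1 / x)) else 0)"

lemma poly_exp_minus_tendsto_0: "((\<lambda>t. poly p t * exp (- t)) \<longlongrightarrow> 0) (at_top :: real filter)"
proof -
  have "((\<lambda>t. \<Sum>i\<le>degree p. coeff p i * (t ^ i / exp t)) \<longlongrightarrow> 0) (at_top :: real filter)"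
    by (intro tendsto_null_sum tendsto_mult_right_zero tendsto_power_div_exp_0)
  then show ?thesis
    by (simp add: poly_altdef sum_distrib_right exp_minus divide_inverse mult.assoc)
qed

text \<open>With t = 1/x, differentiation turns p(t) exp(-t) into t^2 (p(t) - p'(t)) exp(-t), which
  has the same shape. At the origin the one-sided difference quotients tend to 0 since exp(-t) beats
  every polynomial.\<close>

lemma flat_exp_DERIV:
  "(flat_exp p has_real_derivative flat_exp ([:0, 0, 1:] * (p - pderiv p)) x) (at x)"
proof -
  consider "x > 0" | "x < 0" | "x = 0" by linarith
  then show ?thesis
  proof cases
    case 1
    have "((\<lambda>x. poly p (1 / x) * exp (- (1 / x))) has_real_derivative
        flat_exp ([:0, 0, 1:] * (p - pderiv p)) x) (at x)"
      using 1 by (auto intro!: derivative_eq_intros simp: flat_exp_def field_simps power2_eq_square)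
    then show ?thesis
      by (rule has_field_derivative_transform_within_open[where S = "{0<..}"])
         (use 1 in \<open>simp_all add: flat_exp_def\<close>)
  next
    case 2
    have "(flat_exp p has_real_derivative 0) (at x)"
      by (rule has_field_derivative_transform_within_open[where f = "\<lambda>_. 0" and S = "{..<0}"])
         (use 2 in \<open>auto simp: flat_exp_def\<close>)
    then show ?thesis using 2 by (simp add: flat_exp_def)
  next
    case 3
    \<comment> \<open>The difference quotient at 0 carries an extra factor \<open>1 / y\<close>,
      which \<open>pCons 0 p\<close> absorbs.\<close>
    have "((\<lambda>y. poly (pCons 0 p) (1 / y) * exp (- (1 / y))) \<longlongrightarrow> 0) (at_right 0)"
      using filterlim_compose[OF poly_exp_minus_tendsto_0[of "pCons 0 p"] filterlim_inverse_at_top_right]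
      by (simp add: field_simps)
    then have "((\<lambda>y. flat_exp p y / y) \<longlongrightarrow> 0) (at_right 0)"
      by (rule Lim_transform_eventually)
         (auto simp: eventually_at_filter flat_exp_def)
    moreover have "((\<lambda>y. flat_exp p y / y) \<longlongrightarrow> 0) (at_left 0)"
      by (rule Lim_transform_eventually[OF tendsto_const])
         (auto simp: eventually_at_filter flat_exp_def)
    ultimately have "((\<lambda>y. flat_exp p y / y) \<longlongrightarrow> 0) (at 0)"
      by (simp add: filterlim_split_at)
    then show ?thesis
      using 3 by (simp add: has_field_derivative_iff flat_exp_def)
  qed
qed

lemma smooth_flat_exp: "smooth (flat_exp p)"
  by (rule smooth_coinduct[where S = "range flat_exp"]) (use flat_exp_DERIV in blast)+

lemma smooth_bump_exists:
  obtains \<eta> where "smooth \<eta>" "vanishes_off {-1..1} \<eta>" "\<eta> 0 \<noteq> 0"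
proof
  \<comment> \<open>The first factor vanishes for x \<le> -1, the second for x \<ge> 1; the
    arguments are written in the shape of \<open>smooth_affine\<close>.\<close>
  let ?\<eta> = "\<lambda>x. flat_exp 1 (1 * x + 1) * flat_exp 1 ((-1) * x + 1)"
  show "smooth ?\<eta>" by (intro smooth_mult smooth_affine smooth_flat_exp)
  show "vanishes_off {-1..1} ?\<eta>" "?\<eta> 0 \<noteq> 0" by (auto simp: vanishes_off_def flat_exp_def)
qed

section \<open>The shifted operators $-f'' - a f$\<close>

text \<open>Closedness of \<open>S\<close> lets derivatives vanish off the same set. Together with
  \<open>S \<subseteq> {0<..<1}\<close> it forces compact support inside the open interval.\<close>

definition test_fun :: "real set \<Rightarrow> (real \<Rightarrow> real) \<Rightarrow> bool" where
  "test_fun S f \<longleftrightarrow> closed S \<and> smooth f \<and> vanishes_off S f"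

definition opL :: "real \<Rightarrow> (real \<Rightarrow> real) \<Rightarrow> real \<Rightarrow> real" where
  "opL a f = (\<lambda>x. - deriv (deriv f) x - a * f x)"

lemma smooth_lincomb: "smooth f \<Longrightarrow> smooth g \<Longrightarrow> smooth (\<lambda>x. a * f x + b * g x)"
  by (intro smooth_add smooth_cmult)

lemma opL_lincomb_form: "opL a f = (\<lambda>x. (- 1) * deriv (deriv f) x + (- a) * f x)"
  by (simp add: opL_def)

lemma smooth_opL: "smooth f \<Longrightarrow> smooth (opL a f)"
  unfolding opL_lincomb_form by (intro smooth_lincomb smooth_deriv)

lemma test_fun_opL: "test_fun S f \<Longrightarrow> test_fun S (opL a f)"
  using vanishes_off_deriv[of S f] vanishes_off_deriv[of S "deriv f"] smooth_opL[of f a]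
  unfolding test_fun_def by (auto simp: vanishes_off_def opL_def)

lemma test_fun_opLs: "test_fun S f \<Longrightarrow> test_fun S (foldr opL as f)"
  by (induction as) (auto intro: test_fun_opL)

lemma deriv_lincomb:
  assumes "smooth f" "smooth g"
  shows "deriv (\<lambda>x. a * f x + b * g x) = (\<lambda>x. a * deriv f x + b * deriv g x)"
  using assms by (intro ext DERIV_imp_deriv) (auto intro!: derivative_eq_intros smooth_DERIV)

lemma opL_lincomb:
  assumes "smooth f" "smooth g"
  shows "opL c (\<lambda>x. a * f x + b * g x) = (\<lambda>x. a * opL c f x + b * opL c g x)"
  using assms by (simp add: opL_def deriv_lincomb smooth_deriv fun_eq_iff algebra_simps)

lemma smooth_opLs: "smooth f \<Longrightarrow> smooth (foldr opL as f)"
  by (induction as) (auto intro: smooth_opL)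

lemma opLs_lincomb:
  assumes "smooth f" "smooth g"
  shows "foldr opL as (\<lambda>x. a * f x + b * g x) = (\<lambda>x. a * foldr opL as f x + b * foldr opL as g x)"
  using assms by (induction as) (simp_all add: opL_lincomb smooth_opLs)

section \<open>Integration by parts and positivity of powers of -f''\<close>

lemma has_integral_derivative:
  fixes F :: "real \<Rightarrow> real"
  assumes "\<And>x. (F has_real_derivative f x) (at x)" "a \<le> b"
  shows "(f has_integral F b - F a) {a..b}"
  using assms by (intro fundamental_theorem_of_calculus)
    (auto simp flip: has_real_derivative_iff_has_vector_derivative intro: has_field_derivative_at_within)

lemma smooth_integrable: "smooth f \<Longrightarrow> f integrable_on {a..b}"
  by (intro integrable_continuous_real smooth_continuous_on)

text \<open>Integration by parts: the boundary term \<open>deriv u x * v x\<close> is killed by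
  \<open>u\<close> alone, so \<open>v\<close> may be any smooth function.\<close>

lemma integral_opL_0:
  assumes u: "test_fun S u" "a \<notin> S" "b \<notin> S" and v: "smooth v" and "a \<le> b"
  shows "integral {a..b} (\<lambda>x. opL 0 u x * v x) = integral {a..b} (\<lambda>x. deriv u x * deriv v x)"
proof -
  have su: "smooth u" "smooth (deriv u)" "smooth (deriv (deriv u))"
    using u by (auto simp: test_fun_def intro!: smooth_deriv)
  have z: "deriv u a = 0" "deriv u b = 0"
    using u vanishes_off_deriv[of S u] by (auto simp: test_fun_def vanishes_off_def)
  have "((\<lambda>x. deriv u x * v x) has_real_derivative deriv (deriv u) x * v x + deriv u x * deriv v x) (at x)" for x
    using su v by (auto intro!: derivative_eq_intros smooth_DERIV)
  from has_integral_derivative[OF this \<open>a \<le> b\<close>]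
  have "((\<lambda>x. deriv (deriv u) x * v x + deriv u x * deriv v x) has_integral 0) {a..b}"
    by (simp add: z)
  moreover have "((\<lambda>x. deriv u x * deriv v x) has_integral integral {a..b} (\<lambda>x. deriv u x * deriv v x)) {a..b}"
    using su v by (intro integrable_integral smooth_integrable smooth_mult smooth_deriv)
  ultimately have "((\<lambda>x. deriv u x * deriv v x - (deriv (deriv u) x * v x + deriv u x * deriv v x))
      has_integral integral {a..b} (\<lambda>x. deriv u x * deriv v x) - 0) {a..b}"
    by (intro has_integral_diff)
  then show ?thesis
    by (intro integral_unique) (simp add: opL_def)
qed

text \<open>The integral equals that of the square of u'. If it were 0, then u would be constant,
  hence equal to its value 0 at \<open>a\<close>.\<close>

lemma integral_opL_0_pos:
  assumes u: "test_fun S u" "S \<subseteq> {a<..<b}" "u x0 \<noteq> 0"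
  shows "integral {a..b} (\<lambda>x. opL 0 u x * u x) > 0"
proof -
  have su: "smooth u" "smooth (deriv u)"
    using u by (auto simp: test_fun_def intro!: smooth_deriv)
  have "x0 \<in> S" using u by (auto simp: test_fun_def vanishes_off_def)
  then have ab: "a \<le> b" "a < b" "a \<notin> S" "b \<notin> S" using u by force+
  have vd: "vanishes_off S (deriv u)" using u vanishes_off_deriv[of S u] by (auto simp: test_fun_def)
  have "integral {a..b} (\<lambda>x. deriv u x * deriv u x) \<noteq> 0"
  proof
    assume *: "integral {a..b} (\<lambda>x. deriv u x * deriv u x) = 0"
    have "\<forall>x\<in>{a..b}. deriv u x * deriv u x = 0"
      using * su ab by (subst (asm) integral_eq_0_iff)
        (auto intro!: smooth_continuous_on smooth_mult)
    then have "deriv u x = 0" for x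
      using vd u by (cases "x \<in> S") (force simp: vanishes_off_def)+
    then have "(u has_real_derivative 0) (at x)" for x
      using smooth_DERIV[OF su(1), of x] by simp
    then have "u x0 = u a" using DERIV_isconst_all by blast
    moreover have "u a = 0" using u ab by (auto simp: test_fun_def vanishes_off_def)
    ultimately show False using u by simp
  qed
  moreover have "integral {a..b} (\<lambda>x. deriv u x * deriv u x) \<ge> 0"
    by (intro integral_nonneg smooth_integrable smooth_mult su) auto
  ultimately show ?thesis
    using integral_opL_0[OF u(1) ab(3,4) su(1) ab(1)] by simp
qed

lemma integral_opL_0_sym:
  assumes "test_fun S u" "test_fun S v" "a \<notin> S" "b \<notin> S" "a \<le> b"
  shows "integral {a..b} (\<lambda>x. opL 0 u x * v x) = integral {a..b} (\<lambda>x. u x * opL 0 v x)"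
  using integral_opL_0[of S u a b v] integral_opL_0[of S v a b u] assms
  by (simp add: test_fun_def mult.commute)

text \<open>By symmetry, q of the 2q+1 copies of L_0 move to the other factor, which leaves the
  integral of (L_0 v) v with v = L_0^q u. This v is not identically zero, because L_0 never
  annihilates a nonzero test function.\<close>

lemma integral_opL_0_funpow_pos:
  assumes u: "test_fun S u" "S \<subseteq> {a<..<b}" "u x0 \<noteq> 0"
  shows "integral {a..b} (\<lambda>x. (opL 0 ^^ (2 * q + 1)) u x * u x) > 0"
proof -
  have "x0 \<in> S" using u by (auto simp: test_fun_def vanishes_off_def)
  then have ab: "a \<le> b" "a \<notin> S" "b \<notin> S" using u by force+
  have t: "test_fun S ((opL 0 ^^ k) w)" if "test_fun S w" for k w
    using that by (induction k) (auto intro: test_fun_opL)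
  have "\<exists>x. (opL 0 ^^ k) u x \<noteq> 0" for k
  proof (induction k)
    case (Suc k)
    then obtain y where "(opL 0 ^^ k) u y \<noteq> 0" by blast
    from integral_opL_0_pos[OF t[OF u(1)] u(2) this]
    have "integral {a..b} (\<lambda>x. (opL 0 ^^ Suc k) u x * (opL 0 ^^ k) u x) \<noteq> 0" by simp
    then show ?case by (rule contrapos_np) simp
  qed (use u in auto)
  then obtain y where "(opL 0 ^^ q) u y \<noteq> 0" by blast
  note pos = integral_opL_0_pos[OF t[OF u(1)] u(2) this]
  have "integral {a..b} (\<lambda>x. (opL 0 ^^ (k + m)) u x * w x)
      = integral {a..b} (\<lambda>x. (opL 0 ^^ m) u x * (opL 0 ^^ k) w x)" if "test_fun S w" for k m w
    using that
  proof (induction k arbitrary: w)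
    case (Suc k)
    have "integral {a..b} (\<lambda>x. (opL 0 ^^ (Suc k + m)) u x * w x)
       = integral {a..b} (\<lambda>x. (opL 0 ^^ (k + m)) u x * opL 0 w x)"
      using integral_opL_0_sym[OF t[OF u(1), of "k + m"] Suc.prems ab(2,3,1)] by simp
    also have "\<dots> = integral {a..b} (\<lambda>x. (opL 0 ^^ m) u x * (opL 0 ^^ Suc k) w x)"
      by (subst Suc.IH) (auto simp: Suc.prems test_fun_opL funpow_swap1)
    finally show ?case .
  qed auto
  from this[OF u(1), of q "Suc q"] pos show ?thesis
    by (simp add: mult_2)
qed

section \<open>The sine basis and Parseval's identity\<close>

lemma phi_DERIV: "(phi j has_real_derivative sqrt 2 * (real j * pi) * cos (real j * pi * x)) (at x)"
  unfolding phi_def [abs_def] by (auto intro!: derivative_eq_intros)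

lemma phi_DERIV2: "((\<lambda>x. sqrt 2 * (real j * pi) * cos (real j * pi * x)) has_real_derivative - lam j * phi j x) (at x)"
  unfolding phi_def lam_def by (auto intro!: derivative_eq_intros simp: power2_eq_square algebra_simps)

lemma smooth_phi: "smooth (phi j)"
  unfolding phi_def [abs_def] by (rule smooth_sin)

lemma phi_at_ends: "phi j 0 = 0" "phi j 1 = 0"
  by (simp_all add: phi_def sin_npi)

text \<open>Green's identity: f' phi_j - f phi_j' vanishes at both ends and has derivative f'' phi_j
  + \<open>lam j\<close> f phi_j.\<close>

lemma ip_opL_phi:
  assumes "test_fun S f" "S \<subseteq> {0<..<1}"
  shows "ip (opL a f) (phi j) = (lam j - a) * ip f (phi j)"
proof -
  have sf: "smooth f" "smooth (deriv f)" using assms by (auto simp: test_fun_def intro: smooth_deriv)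
  have z: "f 0 = 0" "f 1 = 0" "deriv f 0 = 0" "deriv f 1 = 0"
    using assms vanishes_off_deriv[of S f] by (auto simp: test_fun_def vanishes_off_def)
  let ?c = "\<lambda>x. sqrt 2 * (real j * pi) * cos (real j * pi * x)"
  have "((\<lambda>x. deriv f x * phi j x - f x * ?c x) has_real_derivative
      deriv (deriv f) x * phi j x + lam j * (f x * phi j x)) (at x)" for x
    by (rule derivative_eq_intros smooth_DERIV sf phi_DERIV phi_DERIV2 refl)+ (simp add: algebra_simps)
  from has_integral_derivative[OF this, of 0 1]
  have "((\<lambda>x. deriv (deriv f) x * phi j x + lam j * (f x * phi j x)) has_integral 0) {0..1}"
    by (simp add: z)
  moreover have "((\<lambda>x. (lam j - a) * (f x * phi j x)) has_integral (lam j - a) * ip f (phi j)) {0..1}"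
    unfolding ip_def by (intro has_integral_mult_right integrable_integral smooth_integrable smooth_mult sf smooth_phi)
  ultimately have "((\<lambda>x. (lam j - a) * (f x * phi j x) - (deriv (deriv f) x * phi j x + lam j * (f x * phi j x)))
     has_integral (lam j - a) * ip f (phi j) - 0) {0..1}"
    by (rule has_integral_diff[rotated])
  also have "(\<lambda>x. (lam j - a) * (f x * phi j x) - (deriv (deriv f) x * phi j x + lam j * (f x * phi j x)))
     = (\<lambda>x. opL a f x * phi j x)"
    by (simp add: opL_def fun_eq_iff algebra_simps)
  finally show ?thesis
    unfolding ip_def by (intro integral_unique) simp
qed

text \<open>This converts polynomial weights in \<open>lam j\<close> into differential operators
  acting on \<open>f\<close>: each shift contributes one linear factor.\<close>

lemma ip_opLs_phi:
  assumes "test_fun S f" "S \<subseteq> {0<..<1}"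
  shows "ip (foldr opL as f) (phi j) = (\<Prod>a\<leftarrow>as. lam j - a) * ip f (phi j)"
  using assms by (induction as) (simp_all add: ip_opL_phi[of S] test_fun_opLs)

section \<open>Size, decay and summability of sine coefficients\<close>

lemma ip_abs_le:
  assumes "continuous_on {0..1} f" "continuous_on {0..1} g"
    and "\<And>x. x \<in> {0..1} \<Longrightarrow> \<bar>f x\<bar> \<le> A" "\<And>x. x \<in> {0..1} \<Longrightarrow> \<bar>g x\<bar> \<le> B"
  shows "\<bar>ip f g\<bar> \<le> A * B"
proof -
  have "norm (integral {0..1} (\<lambda>x. f x * g x)) \<le> integral {0..1} (\<lambda>x::real. A * B)"
  proof (rule integral_norm_bound_integral)
    show "(\<lambda>x. f x * g x) integrable_on {0..1}"
      using assms by (intro integrable_continuous_real continuous_intros)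
    fix x :: real assume x: "x \<in> {0..1}"
    then have "\<bar>f x\<bar> * \<bar>g x\<bar> \<le> A * B"
      using assms(3,4) by (intro mult_mono) (auto intro: order_trans[OF abs_ge_zero])
    then show "norm (f x * g x) \<le> A * B" by (simp add: abs_mult)
  qed auto
  then show ?thesis by (simp add: ip_def)
qed

lemma continuous_bounded_on_unit:
  assumes "continuous_on {0..1::real} f"
  obtains B :: real where "B > 0" "\<And>x. x \<in> {0..1} \<Longrightarrow> \<bar>f x\<bar> \<le> B"
proof -
  have "bounded (f ` {0..1})"
    using assms by (intro compact_imp_bounded compact_continuous_image) auto
  then show ?thesis using that by (auto simp: bounded_pos)
qed

lemma abs_phi_le: "\<bar>phi j x\<bar> \<le> 2"
proof -
  have "sqrt 2 * \<bar>sin (real j * pi * x)\<bar> \<le> 2 * 1"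
    by (intro mult_mono) (auto simp: real_le_lsqrt)
  then show ?thesis by (simp add: phi_def abs_mult)
qed

lemma ip_phi_bounded:
  assumes "smooth f" obtains B where "B > 0" "\<And>j. \<bar>ip f (phi j)\<bar> \<le> B"
proof -
  obtain B where B: "B > 0" "\<And>x. x \<in> {0..1} \<Longrightarrow> \<bar>f x\<bar> \<le> B"
    using continuous_bounded_on_unit smooth_continuous_on[OF assms] by blast
  have "\<bar>ip f (phi j)\<bar> \<le> B * 2" for j
    by (intro ip_abs_le smooth_continuous_on assms smooth_phi abs_phi_le B)
  then show ?thesis using that[of "B * 2"] B by simp
qed

text \<open>Applying L_0 k times multiplies the j-th coefficient by \<open>lam j ^ k\<close>, which
  is at least j^(2k), and the coefficients of the resulting smooth function are bounded.\<close>

lemma ip_phi_decay: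
  assumes "test_fun S f" "S \<subseteq> {0<..<1}"
  obtains B where "B > 0" "\<And>j. real j ^ (2 * k) * \<bar>ip f (phi j)\<bar> \<le> B"
proof -
  have "smooth (foldr opL (replicate k 0) f)" using assms unfolding test_fun_def by (intro smooth_opLs) auto
  then obtain B where B: "B > 0" "\<And>j. \<bar>ip (foldr opL (replicate k 0) f) (phi j)\<bar> \<le> B"
    using ip_phi_bounded by blast
  have "real j ^ (2 * k) * \<bar>ip f (phi j)\<bar> \<le> B" for j
  proof -
    have "real j ^ (2 * k) \<le> lam j ^ k"
      unfolding lam_def power_mult using pi_gt3
      by (intro power_mono mult_left_mono[of 1 pi "real j", simplified]) auto
    then have "real j ^ (2 * k) * \<bar>ip f (phi j)\<bar> \<le> lam j ^ k * \<bar>ip f (phi j)\<bar>"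
      by (intro mult_right_mono) auto
    also have "\<dots> = \<bar>ip (foldr opL (replicate k 0) f) (phi j)\<bar>"
      unfolding ip_opLs_phi[OF assms] by (simp add: abs_mult lam_def map_replicate_const prod_list_replicate)
    finally show ?thesis using B(2)[of j] by linarith
  qed
  then show ?thesis using that B by blast
qed

lemma summable_bound_inverse_square:
  fixes f :: "nat \<Rightarrow> real"
  assumes "\<And>i. real (Suc i) ^ 2 * \<bar>f i\<bar> \<le> B"
  shows "summable (\<lambda>i. \<bar>f i\<bar>)"
proof (rule summable_comparison_test')
  have "summable (\<lambda>i. inverse (real (Suc i) ^ 2))"
    using inverse_power_summable[of 2, where 'a = real] by (subst summable_Suc_iff) auto
  then show "summable (\<lambda>i. B * inverse (real (Suc i) ^ 2))" by (rule summable_mult)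
  show "norm \<bar>f i\<bar> \<le> B * inverse (real (Suc i) ^ 2)" if "i \<ge> 0" for i
    using assms[of i] by (simp add: field_simps del: of_nat_Suc)
qed

lemma summable_ip_phi:
  assumes "test_fun S f" "S \<subseteq> {0<..<1}" shows "summable (\<lambda>i. \<bar>ip f (phi (Suc i))\<bar>)"
proof -
  obtain B where "\<And>j. real j ^ (2 * 1) * \<bar>ip f (phi j)\<bar> \<le> B"
    using ip_phi_decay[OF assms] by metis
  then have "real (Suc i) ^ 2 * \<bar>ip f (phi (Suc i))\<bar> \<le> B" for i
    by (metis mult_1_right)
  then show ?thesis by (rule summable_bound_inverse_square)
qed

text \<open>The coefficients of \<open>f\<close> decay like j^(-4n-2), which leaves j^(-2) after the
  weight j^(4n); boundedness is enough for those of \<open>g\<close>.\<close>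

lemma summable_weighted_ip_phi:
  assumes "test_fun S f" "S \<subseteq> {0<..<1}" "smooth g"
  shows "summable (\<lambda>i. real (Suc i) ^ (4 * n) * \<bar>ip f (phi (Suc i)) * ip g (phi (Suc i))\<bar>)"
proof -
  obtain B where B: "B > 0" "\<And>j. real j ^ (2 * (2 * n + 1)) * \<bar>ip f (phi j)\<bar> \<le> B"
    using ip_phi_decay[OF assms(1,2)] by metis
  obtain C where C: "C > 0" "\<And>j. \<bar>ip g (phi j)\<bar> \<le> C"
    using ip_phi_bounded assms by metis
  let ?t = "\<lambda>i. real (Suc i) ^ (4 * n) * (ip f (phi (Suc i)) * ip g (phi (Suc i)))"
  have "real (Suc i) ^ 2 * \<bar>?t i\<bar> \<le> B * C" for i
  proof -
    have "real (Suc i) ^ 2 * \<bar>?t i\<bar>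
       = (real (Suc i) ^ (2 * (2 * n + 1)) * \<bar>ip f (phi (Suc i))\<bar>) * \<bar>ip g (phi (Suc i))\<bar>"
      by (simp add: abs_mult power_add power_mult power2_eq_square power4_eq_xxxx algebra_simps)
    also have "\<dots> \<le> B * C" using B(1) C(1) by (intro mult_mono B(2) C(2)) auto
    finally show ?thesis .
  qed
  then have "summable (\<lambda>i. \<bar>?t i\<bar>)" by (rule summable_bound_inverse_square)
  then show ?thesis by (simp add: abs_mult)
qed

text \<open>For distinct indices the Wronskian phi_j' phi_k - phi_j phi_k' vanishes at both ends,
  and its derivative is \<open>lam k - lam j\<close> times phi_j phi_k. For equal indices an
  explicit antiderivative is used.\<close>

lemma ip_phi_phi:
  assumes "j \<ge> 1" "k \<ge> 1" shows "ip (phi j) (phi k) = (if j = k then 1 else 0)"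
proof (cases "j = k")
  case True
  have "((\<lambda>x. x - sin (2 * real j * pi * x) / (2 * real j * pi)) has_real_derivative phi j x * phi j x) (at x)" for x
  proof -
    have "phi j x * phi j x = 1 - cos (2 * real j * pi * x)"
      using cos_double_sin[of "real j * pi * x"] real_sqrt_mult_self[of 2]
      by (simp add: phi_def power2_eq_square mult.assoc mult.left_commute)
    then show ?thesis using assms by (auto intro!: derivative_eq_intros)
  qed
  from has_integral_derivative[OF this, of 0 1]
  have "((\<lambda>x. phi j x * phi j x) has_integral 1) {0..1}"
    using sin_npi[of "2 * j"] by (simp add: mult.assoc)
  then show ?thesis using True by (simp add: ip_def integral_unique)
next
  case False
  let ?c = "\<lambda>j x. sqrt 2 * (real j * pi) * cos (real j * pi * x)"
  have "((\<lambda>x. ?c j x * phi k x - phi j x * ?c k x) has_real_derivative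
      (lam k - lam j) * (phi j x * phi k x)) (at x)" for x
    by (rule derivative_eq_intros phi_DERIV phi_DERIV2 refl)+ (simp add: algebra_simps)
  from has_integral_derivative[OF this, of 0 1]
  have "((\<lambda>x. (lam k - lam j) * (phi j x * phi k x)) has_integral 0) {0..1}"
    by (simp add: phi_at_ends)
  then have "(lam k - lam j) * ip (phi j) (phi k) = 0"
    unfolding ip_def by (metis integral_mult_right integral_unique)
  moreover have "lam k \<noteq> lam j" using False by (simp add: lam_def power2_eq_iff_nonneg)
  ultimately show ?thesis using False by simp
qed

lemma ip_lincomb_left:
  assumes "continuous_on {0..1} f" "continuous_on {0..1} g" "continuous_on {0..1} h"
  shows "ip (\<lambda>x. a * f x + b * g x) h = a * ip f h + b * ip g h"
proof -
  have "((\<lambda>x. a * (f x * h x) + b * (g x * h x)) has_integral a * ip f h + b * ip g h) {0..1}"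
    unfolding ip_def using assms
    by (intro has_integral_add has_integral_mult_right integrable_integral integrable_continuous_real continuous_intros)
  then show ?thesis unfolding ip_def by (intro integral_unique) (simp add: algebra_simps)
qed

section \<open>Parseval's identity through uniform approximation\<close>

definition parseval_set :: "(real \<Rightarrow> real) \<Rightarrow> (real \<Rightarrow> real) set" where
  "parseval_set g = {f. continuous_on {0..1} f \<and>
     (\<lambda>i. ip f (phi (Suc i)) * ip g (phi (Suc i))) sums ip f g}"

lemma parseval_set_lincomb:
  assumes "f \<in> parseval_set g" "h \<in> parseval_set g" "continuous_on {0..1} g"
  shows "(\<lambda>x. a * f x + b * h x) \<in> parseval_set g"
proof -
  have c: "continuous_on {0..1} f" "continuous_on {0..1} h" using assms by (auto simp: parseval_set_def)
  have "(\<lambda>i. a * (ip f (phi (Suc i)) * ip g (phi (Suc i))) + b * (ip h (phi (Suc i)) * ip g (phi (Suc i))))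
     sums (a * ip f g + b * ip h g)"
    using assms by (intro sums_add sums_mult) (auto simp: parseval_set_def)
  moreover have "continuous_on {0..1} (\<lambda>x. a * f x + b * h x)"
    using c by (intro continuous_intros)
  ultimately show ?thesis
    unfolding parseval_set_def mem_Collect_eq ip_lincomb_left[OF c smooth_continuous_on[OF smooth_phi]]
      ip_lincomb_left[OF c assms(3)]
    by (simp add: distrib_right mult.assoc)
qed

lemma phi_in_parseval_set: "phi j \<in> parseval_set g"
proof (cases "j = 0")
  case True
  then have "phi j = (\<lambda>x. 0)" by (auto simp: phi_def)
  then show ?thesis by (simp add: parseval_set_def ip_def)
next
  case False
  have "(\<lambda>i. if i = j - 1 then ip g (phi (Suc i)) else 0) sums ip g (phi (Suc (j - 1)))"
    by (rule sums_single)
  moreover have "(\<lambda>i. if i = j - 1 then ip g (phi (Suc i)) else 0) = (\<lambda>i. ip (phi j) (phi (Suc i)) * ip g (phi (Suc i)))"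
    using False by (auto simp: ip_phi_phi)
  moreover have "ip g (phi (Suc (j - 1))) = ip (phi j) g"
    using False by (simp add: ip_def mult.commute)
  ultimately show ?thesis by (simp add: parseval_set_def smooth_continuous_on smooth_phi)
qed

text \<open>Product-to-sum formula: a factor cos(pi x) moves the frequency to its two neighbours.
  Since \<open>phi 0\<close> is identically 0, the lowest frequency is no exception.\<close>

lemma phi_times_cos: "phi (Suc j) x * cos (pi * x) = 1/2 * phi (Suc (Suc j)) x + 1/2 * phi j x"
proof -
  have "sin (A + B) + sin (A - B) = 2 * (sin A * cos B)" for A B :: real
    by (simp add: sin_add sin_diff)
  from this[of "real (Suc j) * pi * x" "pi * x"]
  have "2 * (sin (real (Suc j) * pi * x) * cos (pi * x)) = sin (real (Suc (Suc j)) * pi * x) + sin (real j * pi * x)"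
    by (simp add: distrib_right add.assoc mult.assoc)
  then have "sqrt 2 * (2 * (sin (real (Suc j) * pi * x) * cos (pi * x)))
      = sqrt 2 * (sin (real (Suc (Suc j)) * pi * x) + sin (real j * pi * x))" by (rule arg_cong)
  then show ?thesis unfolding phi_def by (simp only: distrib_left)
qed

text \<open>Induction on the polynomial with \<open>j\<close> generalised, because each factor
  cos(pi x) changes the index.\<close>

lemma phi_times_poly_cos_in_parseval_set:
  assumes "continuous_on {0..1} g"
  shows "(\<lambda>x. phi j x * poly q (cos (pi * x))) \<in> parseval_set g"
proof (induction q arbitrary: j)
  case 0
  then show ?case by (simp add: parseval_set_def ip_def)
next
  case (pCons a q)
  show ?case
  proof (cases j)
    case 0
    then have "phi j = (\<lambda>x. 0)" by (auto simp: phi_def)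
    then show ?thesis by (simp add: parseval_set_def ip_def)
  next
    case (Suc i)
    let ?P = "\<lambda>j x. phi j x * poly q (cos (pi * x))"
    have "(\<lambda>x. a * phi j x + 1 * (1/2 * ?P (Suc (Suc i)) x + 1/2 * ?P i x)) \<in> parseval_set g"
      by (intro parseval_set_lincomb phi_in_parseval_set pCons assms)
    also have "(\<lambda>x. a * phi j x + 1 * (1/2 * ?P (Suc (Suc i)) x + 1/2 * ?P i x))
      = (\<lambda>x. phi j x * poly (pCons a q) (cos (pi * x)))"
    proof
      fix x
      have "phi j x * poly (pCons a q) (cos (pi * x))
         = a * phi j x + (phi (Suc i) x * cos (pi * x)) * poly q (cos (pi * x))"
        by (simp add: Suc algebra_simps)
      then show "a * phi j x + 1 * (1/2 * ?P (Suc (Suc i)) x + 1/2 * ?P i x)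
         = phi j x * poly (pCons a q) (cos (pi * x))"
        unfolding phi_times_cos by (simp add: algebra_simps)
    qed
    finally show ?thesis .
  qed
qed

text \<open>Stone-Weierstrass: cos(pi x) is injective on the unit interval, so the polynomials in it
  separate points.\<close>

lemma poly_cos_dense:
  assumes "continuous_on {0..1} f" "e > 0"
  obtains q where "\<And>x. x \<in> {0..1} \<Longrightarrow> \<bar>f x - poly q (cos (pi * x))\<bar> < e"
proof -
  define R where "R = range (\<lambda>q (x::real). poly q (cos (pi * x)) :: real)"
  interpret function_ring_on R "{0..1}"
  proof
    show "compact {0..1::real}" by simp
    fix f assume "f \<in> R"
    then show "continuous_on {0..1} f"
      unfolding R_def by (auto intro!: continuous_on_poly continuous_on_cos continuous_on_mult continuous_on_const continuous_on_id)
  next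
    fix f g assume "f \<in> R" "g \<in> R"
    then obtain p q where "f = (\<lambda>x. poly p (cos (pi * x)))" "g = (\<lambda>x. poly q (cos (pi * x)))"
      unfolding R_def by blast
    then have "(\<lambda>x. f x + g x) = (\<lambda>x. poly (p + q) (cos (pi * x)))"
      "(\<lambda>x. f x * g x) = (\<lambda>x. poly (p * q) (cos (pi * x)))" by auto
    then show "(\<lambda>x. f x + g x) \<in> R" "(\<lambda>x. f x * g x) \<in> R" unfolding R_def by blast+
  next
    fix c have "(\<lambda>_. c) = (\<lambda>x. poly [:c:] (cos (pi * x)))" by auto
    then show "(\<lambda>_. c) \<in> R" unfolding R_def by blast
  next
    fix x y :: real assume xy: "x \<in> {0..1}" "y \<in> {0..1}" "x \<noteq> y"
    have "cos (pi * x) \<noteq> cos (pi * y)"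
      using xy cos_inj_pi[of "pi * x" "pi * y"] by (auto simp: mult_le_cancel_left1)
    then have "poly [:0, 1:] (cos (pi * x)) \<noteq> poly [:0, 1:] (cos (pi * y))" by simp
    moreover have "(\<lambda>x. poly [:0, 1:] (cos (pi * x))) \<in> R" unfolding R_def by (rule rangeI)
    ultimately show "\<exists>f\<in>R. f x \<noteq> f y" by (rule bexI)
  qed
  obtain h where h: "h \<in> R" "\<forall>x\<in>{0..1}. \<bar>f x - h x\<bar> < e"
    using Stone_Weierstrass_basic[OF assms] by blast
  then obtain q where "h = (\<lambda>x. poly q (cos (pi * x)))" unfolding R_def by blast
  then show ?thesis using that[of q] h(2) by simp
qed

lemma phi_1_pos: assumes "0 < x" "x < 1" shows "phi 1 x > 0"
  using assms sin_gt_zero[of "pi * x"] by (simp add: phi_def)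

lemma smooth_divide_phi_1:
  assumes "test_fun S f" "S \<subseteq> {0<..<1}" shows "smooth (\<lambda>x. f x / phi 1 x)"
proof (rule smooth_divide[where S = S])
  fix x assume "x \<in> S"
  then show "phi 1 x \<noteq> 0" using assms phi_1_pos[of x] by auto
qed (use assms in \<open>auto simp: test_fun_def smooth_phi\<close>)

text \<open>
  Both sides are bounded linear functionals of $f$ for the sup norm, since the coefficients of $g$ are
  summable. They agree on $\varphi_1 q(\cos \pi x)$ for polynomials $q$, and these are uniformly close to
  $f$ because $f / \varphi_1$ is continuous.
\<close>
theorem parseval:
  assumes f: "test_fun S f" and g: "test_fun T g" and S: "S \<subseteq> {0<..<1}" and T: "T \<subseteq> {0<..<1}"
  shows "(\<lambda>i. ip f (phi (Suc i)) * ip g (phi (Suc i))) sums ip f g"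
proof -
  let ?b = "\<lambda>i. ip g (phi (Suc i))"
  have sf: "smooth f" and sg: "smooth g" using f g by (auto simp: test_fun_def)
  have cf: "continuous_on {0..1} f" and cg: "continuous_on {0..1} g"
    using sf sg by (auto intro: smooth_continuous_on)
  have sb: "summable (\<lambda>i. \<bar>?b i\<bar>)" by (rule summable_ip_phi[OF g T])
  obtain G where G: "G > 0" "\<And>x. x \<in> {0..1} \<Longrightarrow> \<bar>g x\<bar> \<le> G"
    using continuous_bounded_on_unit[OF cg] by blast
  obtain F where F: "F > 0" "\<And>j. \<bar>ip f (phi j)\<bar> \<le> F"
    using ip_phi_bounded[OF sf] by blast
  have sums: "summable (\<lambda>i. ip f (phi (Suc i)) * ?b i)"
  proof (rule summable_comparison_test')
    show "summable (\<lambda>i. F * \<bar>?b i\<bar>)" using sb by (rule summable_mult)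
    show "norm (ip f (phi (Suc i)) * ?b i) \<le> F * \<bar>?b i\<bar>" if "i \<ge> 0" for i
      using F by (auto simp: abs_mult intro!: mult_right_mono)
  qed
  have smf: "smooth (\<lambda>x. f x / phi 1 x)" by (rule smooth_divide_phi_1[OF f S])
  have fdiv: "f x = phi 1 x * (f x / phi 1 x)" for x
  proof (cases "x \<in> S")
    case True
    then show ?thesis using S phi_1_pos[of x] by auto
  next
    case False
    then show ?thesis using f by (simp add: test_fun_def vanishes_off_def)
  qed
  define E where "E = ip f g - (\<Sum>i. ip f (phi (Suc i)) * ?b i)"
  \<comment> \<open>The approximation error \<open>d\<close> satisfies |d| \<le> 2e, so its
    coefficients are at most 4e in size. The integral against \<open>g\<close> then contributes 2eG
    and the series 4e times the sum of the |b_i|.\<close>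
  define C where "C = 2 * G + 4 * (\<Sum>i. \<bar>?b i\<bar>)"
  have "\<bar>E\<bar> \<le> e * C" if e: "e > 0" for e
  proof -
    obtain q where q: "\<And>x. x \<in> {0..1} \<Longrightarrow> \<bar>f x / phi 1 x - poly q (cos (pi * x))\<bar> < e"
      using poly_cos_dense[OF smooth_continuous_on[OF smf] e] by blast
    define t where "t x = phi 1 x * poly q (cos (pi * x))" for x
    have t: "t \<in> parseval_set g"
      unfolding t_def [abs_def] by (rule phi_times_poly_cos_in_parseval_set[OF cg])
    then have ct: "continuous_on {0..1} t" and st: "(\<lambda>i. ip t (phi (Suc i)) * ?b i) sums ip t g"
      by (auto simp: parseval_set_def)
    define d where "d x = 1 * f x + (-1) * t x" for x
    have cd: "continuous_on {0..1} d" unfolding d_def [abs_def] using cf ct by (intro continuous_intros)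
    have d: "\<bar>d x\<bar> \<le> 2 * e" if "x \<in> {0..1}" for x
    proof -
      have "d x = phi 1 x * (f x / phi 1 x - poly q (cos (pi * x)))"
        using fdiv[of x] by (simp add: d_def t_def algebra_simps)
      then have "\<bar>d x\<bar> = \<bar>phi 1 x\<bar> * \<bar>f x / phi 1 x - poly q (cos (pi * x))\<bar>" by (simp add: abs_mult)
      also have "\<dots> \<le> 2 * e" using abs_phi_le q[OF that] by (intro mult_mono) auto
      finally show ?thesis .
    qed
    have dphi: "\<bar>ip d (phi j)\<bar> \<le> 2 * e * 2" for j
      by (intro ip_abs_le cd smooth_continuous_on smooth_phi d abs_phi_le)
    have "(\<lambda>i. 1 * (ip f (phi (Suc i)) * ?b i) + (-1) * (ip t (phi (Suc i)) * ?b i)) sums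
        (1 * (\<Sum>i. ip f (phi (Suc i)) * ?b i) + (-1) * ip t g)"
      using sums st by (intro sums_add sums_mult) (auto simp: summable_sums)
    then have sd: "(\<lambda>i. ip d (phi (Suc i)) * ?b i) sums ((\<Sum>i. ip f (phi (Suc i)) * ?b i) - ip t g)"
      unfolding d_def [abs_def] ip_lincomb_left[OF cf ct smooth_continuous_on[OF smooth_phi]]
      by (simp add: left_diff_distrib)
    have "ip d g = ip f g - ip t g"
      unfolding d_def [abs_def] using cf ct cg by (subst ip_lincomb_left) auto
    \<comment> \<open>Parseval holds exactly for \<open>t\<close>, so \<open>f\<close> and
      \<open>d\<close>, which is f - t, have the same defect.\<close>
    then have E: "E = ip d g - (\<Sum>i. ip d (phi (Suc i)) * ?b i)"
      using sums_unique[OF sd] by (simp add: E_def)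
    have "\<bar>ip d g\<bar> \<le> 2 * e * G" by (intro ip_abs_le cd cg d G)
    moreover have "\<bar>\<Sum>i. ip d (phi (Suc i)) * ?b i\<bar> \<le> (\<Sum>i. 2 * e * 2 * \<bar>?b i\<bar>)"
    proof -
      have "norm (\<Sum>i. ip d (phi (Suc i)) * ?b i) \<le> (\<Sum>i. 2 * e * 2 * \<bar>?b i\<bar>)"
        using dphi sb by (intro norm_suminf_le summable_mult) (auto simp: abs_mult intro!: mult_right_mono)
      then show ?thesis by simp
    qed
    moreover have "(\<Sum>i. 2 * e * 2 * \<bar>?b i\<bar>) = 2 * e * 2 * (\<Sum>i. \<bar>?b i\<bar>)"
      using sb by (rule suminf_mult)
    ultimately show ?thesis unfolding E C_def by (simp add: algebra_simps)
  qed
  note bound = this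
  have C: "C > 0" using G suminf_nonneg[OF sb] by (simp add: C_def add_pos_nonneg)
  have "E = 0"
  proof (rule ccontr)
    assume "E \<noteq> 0"
    \<comment> \<open>This choice of e turns the bound into |E| \<le> |E| / 2.\<close>
    then show False using C bound[of "\<bar>E\<bar> / (2 * C)"] by simp
  qed
  then show ?thesis using sums by (simp add: E_def sums_iff)
qed

section \<open>Energies of concentrated bumps\<close>

text \<open>This is the form Q_p(h) of the overview: \<open>as\<close> lists the shifts of L_m
  (L_{\<lambda>_K} L_{\<lambda>_1})^(p-1), while \<open>c\<close> and \<open>w\<close> stand for
  \<lambda>_K and phi_K / phi_1.\<close>

definition energy :: "real list \<Rightarrow> real \<Rightarrow> (real \<Rightarrow> real) \<Rightarrow> (real \<Rightarrow> real) \<Rightarrow> real" where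
  "energy as c w h = integral {0..1} (\<lambda>x. foldr opL as (opL c h) x * (opL c h x * w x))"

text \<open>Two derivatives of the rescaled function cost 1/e^2, so the shift becomes e^2 a and
  fades as e tends to 0. The scalar \<open>C\<close> allows the formula to be iterated.\<close>

lemma opL_scaled:
  assumes "smooth f" "e \<noteq> 0"
  shows "opL a (\<lambda>x. C * f ((x - x0) / e)) = (\<lambda>x. C * (1 / e\<^sup>2) * opL (e\<^sup>2 * a) f ((x - x0) / e))"
proof -
  have d: "deriv (\<lambda>x. D * g ((x - x0) / e)) = (\<lambda>x. D / e * deriv g ((x - x0) / e))" if "smooth g" for g D
    using that assms(2)
    by (intro ext DERIV_imp_deriv) (auto intro!: derivative_eq_intros smooth_DERIV_chain)
  show ?thesis
    unfolding opL_def d[OF assms(1)] d[OF smooth_deriv[OF assms(1)]]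
    using assms(2) by (auto simp: fun_eq_iff field_simps power2_eq_square)
qed

lemma opLs_scaled:
  assumes "smooth f" "e \<noteq> 0"
  shows "foldr opL as (\<lambda>x. f ((x - x0) / e))
    = (\<lambda>x. (1 / e\<^sup>2) ^ length as * foldr opL (map ((*) (e\<^sup>2)) as) f ((x - x0) / e))"
proof (induction as)
  case (Cons a as)
  have "smooth (foldr opL (map ((*) (e\<^sup>2)) as) f)" using assms by (intro smooth_opLs)
  from opL_scaled[OF this assms(2)] Cons show ?case by (simp add: mult.commute[of "1 / e\<^sup>2"])
qed simp

lemma funpow_deriv_lincomb:
  assumes "smooth f" "smooth g"
  shows "(deriv ^^ k) (\<lambda>x. a * f x + b * g x) = (\<lambda>x. a * (deriv ^^ k) f x + b * (deriv ^^ k) g x)"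
  using assms by (induction k) (simp_all add: deriv_lincomb smooth_funpow_deriv)

text \<open>Joint continuity in the scale and the space variable lets the limit e = 0 pass under the
  integral. All derivatives are included because every further operator raises the order by
  two.\<close>

lemma continuous_opLs_param:
  assumes "smooth f"
  shows "continuous_on UNIV (\<lambda>z. (deriv ^^ k) (foldr opL (map ((*) ((fst z)\<^sup>2)) as) f) (snd z))"
proof (induction as arbitrary: k)
  case Nil
  have "continuous_on UNIV ((deriv ^^ k) f)" using assms by (intro smooth_continuous_on smooth_funpow_deriv)
  then show ?case
    using continuous_on_compose2[of UNIV "(deriv ^^ k) f" UNIV snd] by (simp add: continuous_on_snd)
next
  case (Cons a as)
  let ?G = "\<lambda>z. foldr opL (map ((*) ((fst z :: real)\<^sup>2)) as) f"
  have "(deriv ^^ k) (foldr opL (map ((*) ((fst z)\<^sup>2)) (a # as)) f) y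
      = - 1 * (deriv ^^ Suc (Suc k)) (?G z) y + - ((fst z)\<^sup>2 * a) * (deriv ^^ k) (?G z) y" for z :: "real \<times> real" and y
  proof -
    have s: "smooth (?G z)" using assms by (rule smooth_opLs)
    have "(deriv ^^ k) (deriv (deriv (?G z))) = (deriv ^^ Suc (Suc k)) (?G z)"
      by (simp add: funpow_swap1)
    then show ?thesis
      using funpow_deriv_lincomb[OF smooth_deriv[OF smooth_deriv[OF s]] s, of k "-1" "- ((fst z)\<^sup>2 * a)"]
      by (simp add: opL_lincomb_form)
  qed
  then show ?case
    by (simp only:) (intro continuous_intros Cons continuous_on_fst continuous_on_id)
qed

text \<open>Substitution y = (x - x0) / e: the \<open>length as + 2\<close> operators in the two
  factors give 1/e^2 each, and dx gives e. The window of radius 2 contains the support {-1..1} in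
  its interior, as the positivity lemmas require.\<close>

lemma energy_scaled:
  assumes f: "test_fun {-1..1} f" and e: "e > 0" and x0: "0 \<le> x0 - 2 * e" "x0 + 2 * e \<le> 1"
    and w: "continuous_on {x0 - 2 * e..x0 + 2 * e} w"
  shows "energy as c w (\<lambda>x. f ((x - x0) / e)) = e * (1 / e\<^sup>2) ^ (length as + 2) *
    integral {-2..2} (\<lambda>y. foldr opL (map ((*) (e\<^sup>2)) (as @ [c])) f y
      * (foldr opL (map ((*) (e\<^sup>2)) [c]) f y * w (x0 + e * y)))"
proof -
  have sf: "smooth f" using f by (simp add: test_fun_def)
  let ?G = "foldr opL (map ((*) (e\<^sup>2)) (as @ [c])) f"
  let ?H = "foldr opL (map ((*) (e\<^sup>2)) [c]) f"
  let ?I = "\<lambda>y. ?G y * (?H y * w (x0 + e * y))"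
  let ?C = "(1 / e\<^sup>2) ^ (length as + 2)"
  let ?h = "\<lambda>x. f ((x - x0) / e)"
  have eq: "foldr opL as (opL c ?h) x * (opL c ?h x * w x) = ?C * ?I ((x - x0) / e)" for x
    using fun_cong[OF opLs_scaled[OF sf, of e "as @ [c]" x0], of x] fun_cong[OF opLs_scaled[OF sf, of e "[c]" x0], of x] e
    by (simp add: power_add power2_eq_square mult_ac)
  have H0: "?H y = 0" if "y \<notin> {-1..1}" for y
    using test_fun_opLs[OF f, of "map ((*) (e\<^sup>2)) [c]"] that by (simp add: test_fun_def vanishes_off_def)
  have "continuous_on {-2..2} (\<lambda>y. w (x0 + e * y))"
  proof (rule continuous_on_compose2[OF w])
    have "e * (- 2) \<le> e * y \<and> e * y \<le> e * 2" if "y \<in> {-2..2}" for y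
      using e that by (intro conjI mult_left_mono) auto
    then show "(\<lambda>y. x0 + e * y) ` {-2..2} \<subseteq> {x0 - 2 * e..x0 + 2 * e}" by (fastforce simp: mult.commute)
  qed (intro continuous_intros)
  then have cI: "continuous_on {-2..2} ?I"
    by (intro continuous_on_mult smooth_continuous_on[OF smooth_opLs[OF sf]])
  have "(\<lambda>x. foldr opL as (opL c ?h) x * (opL c ?h x * w x))
      = (\<lambda>x. if x \<in> {x0 - 2 * e..x0 + 2 * e} then ?C * ?I ((x - x0) / e) else 0)"
  proof
    fix x
    show "foldr opL as (opL c ?h) x * (opL c ?h x * w x)
       = (if x \<in> {x0 - 2 * e..x0 + 2 * e} then ?C * ?I ((x - x0) / e) else 0)"
    proof (cases "x \<in> {x0 - 2 * e..x0 + 2 * e}")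
      case True
      then show ?thesis using eq[of x] by (simp only: if_True)
    next
      case False
      then have "(x - x0) / e \<notin> {-1..1}" using e by (auto simp: field_simps)
      then have "?H ((x - x0) / e) = 0" by (rule H0)
      then have "?C * ?I ((x - x0) / e) = 0" by (simp only: mult_zero_left mult_zero_right)
      then show ?thesis using False eq[of x] by (simp only: if_False)
    qed
  qed
  then have "energy as c w ?h
      = integral {0..1} (\<lambda>x. if x \<in> {x0 - 2 * e..x0 + 2 * e} then ?C * ?I ((x - x0) / e) else 0)"
    by (simp only: energy_def)
  also have "\<dots> = integral {x0 - 2 * e..x0 + 2 * e} (\<lambda>x. ?C * ?I ((x - x0) / e))"
  proof -
    have "{x0 - 2 * e..x0 + 2 * e} \<inter> {0..1} = {x0 - 2 * e..x0 + 2 * e}" using x0 by auto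
    then show ?thesis by (simp only: integral_restrict_Int)
  qed
  also have "\<dots> = e * ?C * integral {-2..2} ?I"
  proof -
    have "((\<lambda>x. (1 / e) *\<^sub>R ?I ((x - x0) / e)) has_integral
        (integral {(x0 - 2 * e - x0) / e..(x0 + 2 * e - x0) / e} ?I)) {x0 - 2 * e..x0 + 2 * e}"
    proof (rule has_integral_substitution[where c = "-2" and d = 2])
      show "(\<lambda>x. (x - x0) / e) ` {x0 - 2 * e..x0 + 2 * e} \<subseteq> {- 2..2}" using e by (auto simp: field_simps)
      show "((\<lambda>x. (x - x0) / e) has_field_derivative 1 / e) (at x within {x0 - 2 * e..x0 + 2 * e})" for x
        using e by (auto intro!: derivative_eq_intros)
    qed (use e cI in \<open>auto simp: field_simps\<close>)
    then have "((\<lambda>x. (e * ?C) * ((1 / e) *\<^sub>R ?I ((x - x0) / e))) has_integral (e * ?C) * integral {-2..2} ?I)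
        {x0 - 2 * e..x0 + 2 * e}"
      using e by (intro has_integral_mult_right) simp
    then show ?thesis using e by (intro integral_unique) (simp add: mult.assoc)
  qed
  finally show ?thesis .
qed

text \<open>At e = 0 all shifts vanish and \<open>w\<close> freezes at \<open>x0\<close>, leaving
  the integral of (L_0^(2q+1) F) F with F = L_0 f, which is positive because the number of operators
  is odd.\<close>

lemma energy_limit:
  assumes f: "test_fun {-1..1} f" "f y0 \<noteq> 0" and r: "r > 0" and w: "continuous_on {x0 - r..x0 + r} w"
    and as: "length as = 2 * q + 1"
  obtains L where "L > 0"
    "((\<lambda>e. integral {-2..2} (\<lambda>y. foldr opL (map ((*) (e\<^sup>2)) (as @ [c])) f y
      * (foldr opL (map ((*) (e\<^sup>2)) [c]) f y * w (x0 + e * y)))) \<longlongrightarrow> L * w x0) (at_right 0)"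
proof -
  have sf: "smooth f" using f by (simp add: test_fun_def)
  let ?G = "\<lambda>bs e. foldr opL (map ((*) (e\<^sup>2)) bs) f"
  let ?I = "\<lambda>e y. ?G (as @ [c]) e y * (?G [c] e y * w (x0 + e * y))"
  have cG: "continuous_on ({0..r / 2} \<times> cbox (-2) 2) (\<lambda>z. ?G bs (fst z) (snd z))" for bs
    using continuous_on_subset[OF continuous_opLs_param[OF sf, of 0 bs]] by simp
  have "continuous_on ({0..r / 2} \<times> cbox (-2) 2) (\<lambda>z. ?I (fst z) (snd z))"
  proof (intro continuous_on_mult cG)
    have "x0 - r \<le> x0 + e * y \<and> x0 + e * y \<le> x0 + r" if "0 \<le> e" "e \<le> r / 2" "-2 \<le> y" "y \<le> 2" for e y
    proof -
      have "\<bar>e * y\<bar> \<le> (r / 2) * 2" unfolding abs_mult using that by (intro mult_mono) auto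
      then show ?thesis by auto
    qed
    then show "continuous_on ({0..r / 2} \<times> cbox (-2) 2) (\<lambda>z. w (x0 + fst z * snd z))"
      by (intro continuous_on_compose2[OF w] continuous_intros) auto
  qed
  then have "continuous_on {0..r / 2} (\<lambda>e. integral (cbox (-2) 2) (?I e))"
    by (intro integral_continuous_on_param) (simp add: case_prod_beta)
  then have "\<forall>x\<in>{0..r / 2}. ((\<lambda>e. integral {-2..2} (?I e)) \<longlongrightarrow> integral {-2..2} (?I x)) (at x within {0..r / 2})"
    unfolding continuous_on_def by (simp only: interval_cbox)
  then have "((\<lambda>e. integral {-2..2} (?I e)) \<longlongrightarrow> integral {-2..2} (?I 0)) (at 0 within {0..r / 2})"
    by (rule bspec) (use r in simp)
  moreover have "at 0 within {0..r / 2} = at_right (0::real)"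
    using r by (simp add: at_within_Icc_at_right)
  ultimately have lim: "((\<lambda>e. integral {-2..2} (?I e)) \<longlongrightarrow> integral {-2..2} (?I 0)) (at_right 0)"
    by (simp only:)
  define F where "F = opL 0 f"
  have F: "test_fun {-1..1} F" unfolding F_def using f by (intro test_fun_opL)
  \<comment> \<open>Positivity here shows that \<open>F\<close> does not vanish identically.\<close>
  have "integral {-2..2} (\<lambda>x. F x * f x) > 0"
    unfolding F_def using f by (intro integral_opL_0_pos[where S = "{-1..1}"]) auto
  then have "(\<lambda>x. F x * f x) \<noteq> (\<lambda>x. 0)" by (intro notI) simp
  then obtain y where "F y \<noteq> 0" by force
  then have pos: "integral {-2..2} (\<lambda>x. (opL 0 ^^ (2 * q + 1)) F x * F x) > 0"
    using F by (intro integral_opL_0_funpow_pos[where S = "{-1..1}"]) auto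
  have "?I 0 y = ((opL 0 ^^ (2 * q + 1)) F y * F y) * w x0" for y
  proof -
    have "map ((*) (0\<^sup>2)) as = map (\<lambda>_. 0::real) as" by simp
    also have "\<dots> = replicate (2 * q + 1) 0" unfolding map_replicate_const as ..
    finally have "foldr opL (map ((*) (0\<^sup>2)) (as @ [c])) f = (opL 0 ^^ (2 * q + 1)) F"
      by (simp only: map_append foldr_append foldr_replicate) (simp add: F_def)
    moreover have "foldr opL (map ((*) (0\<^sup>2)) [c]) f = F" by (simp add: F_def)
    ultimately show ?thesis by (simp only: mult.assoc) simp
  qed
  then have "integral {-2..2} (?I 0) = integral {-2..2} (\<lambda>x. (opL 0 ^^ (2 * q + 1)) F x * F x) * w x0"
    by (simp only: integral_mult_left)
  then show ?thesis using that[OF pos] lim by (simp only:)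
qed

text \<open>The scale enters as e^(-4p-1), and the remaining integrals converge to positive
  multiples of \<open>w x0\<close>. For small e the signs are therefore those of
  \<open>w x0\<close>, and the ratios, of order e^(-4), exceed \<open>M\<close>. Finitely many p
  allow one common e.\<close>

lemma energy_bump:
  fixes A :: "nat \<Rightarrow> real list"
  assumes A: "\<And>p. p \<ge> 1 \<Longrightarrow> length (A p) = 2 * p - 1"
    and s: "s * w x0 > 0" and r: "r > 0" "0 < x0 - r" "x0 + r < 1"
    and w: "continuous_on {x0 - r..x0 + r} w"
  shows "\<exists>h. test_fun {x0 - r..x0 + r} h \<and> (\<forall>p\<in>{1..N}. s * energy (A p) c w h > 0 \<and>
    s * energy (A (p + 1)) c w h \<ge> M * (s * energy (A p) c w h))"
proof -
  obtain f where f: "smooth f" "vanishes_off {-1..1} f" "f 0 \<noteq> 0" by (rule smooth_bump_exists)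
  have tf: "test_fun {-1..1} f" using f by (simp add: test_fun_def)
  define J where "J p e = integral {-2..2} (\<lambda>y. foldr opL (map ((*) (e\<^sup>2)) (A p @ [c])) f y
      * (foldr opL (map ((*) (e\<^sup>2)) [c]) f y * w (x0 + e * y)))" for p and e :: real
  have "\<exists>L>0. (J p \<longlongrightarrow> L * w x0) (at_right 0)" if "p \<ge> 1" for p
  proof -
    have "length (A p) = 2 * (p - 1) + 1" using A[OF that] that by simp
    then obtain L where "L > 0" "(J p \<longlongrightarrow> L * w x0) (at_right 0)"
      unfolding J_def [abs_def] by (rule energy_limit[OF tf f(3) r(1) w])
    then show ?thesis by blast
  qed
  then obtain L where L: "\<And>p. p \<ge> 1 \<Longrightarrow> L p > 0" "\<And>p. p \<ge> 1 \<Longrightarrow> (J p \<longlongrightarrow> L p * w x0) (at_right 0)"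
    by metis
  have pos: "eventually (\<lambda>e. s * J p e > 0) (at_right 0)" if "p \<ge> 1" for p
  proof -
    have "((\<lambda>e. s * J p e) \<longlongrightarrow> s * (L p * w x0)) (at_right 0)"
      by (intro tendsto_intros L that)
    moreover have "s * (L p * w x0) > 0" using mult_pos_pos[OF L(1)[OF that] s] by (simp only: mult.left_commute)
    ultimately show ?thesis by (rule order_tendstoD)
  qed
  \<comment> \<open>The desired growth multiplied by e^4 and stripped of the common scale factor; in
    the limit only the first term survives.\<close>
  have ratio: "eventually (\<lambda>e. s * J (p + 1) e - e ^ 4 * (M * (s * J p e)) > 0) (at_right 0)" if "p \<ge> 1" for p
  proof -
    have "((\<lambda>e. s * J (p + 1) e - e ^ 4 * (M * (s * J p e))) \<longlongrightarrow>
        s * (L (p + 1) * w x0) - 0 ^ 4 * (M * (s * (L p * w x0)))) (at_right 0)"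
      using that by (intro tendsto_intros L) auto
    moreover have "s * (L (p + 1) * w x0) - 0 ^ 4 * (M * (s * (L p * w x0))) > 0"
      using mult_pos_pos[OF L(1)[of "p + 1"] s] by (simp add: mult.left_commute)
    ultimately show ?thesis by (rule order_tendstoD)
  qed
  \<comment> \<open>The bound r/2 keeps the window of radius 2e inside the interval on which
    \<open>w\<close> is continuous.\<close>
  have "eventually (\<lambda>e. e \<in> {0<..<r / 2} \<and> (\<forall>p\<in>{1..N}. s * J p e > 0 \<and>
      s * J (p + 1) e - e ^ 4 * (M * (s * J p e)) > 0)) (at_right 0)"
    using r by (intro eventually_conj eventually_at_right_real eventually_ball_finite ballI pos ratio) auto
  from eventually_happens'[OF trivial_limit_at_right_real this]
  obtain e where "e \<in> {0<..<r / 2} \<and> (\<forall>p\<in>{1..N}. s * J p e > 0 \<and>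
      s * J (p + 1) e - e ^ 4 * (M * (s * J p e)) > 0)" by (rule exE)
  then have e: "0 < e" "e < r / 2" and
    J: "\<And>p. p \<in> {1..N} \<Longrightarrow> s * J p e > 0" "\<And>p. p \<in> {1..N} \<Longrightarrow> s * J (p + 1) e - e ^ 4 * (M * (s * J p e)) > 0"
    by simp_all
  define h where "h x = f ((x - x0) / e)" for x
  have en: "energy (A p) c w h = e * (1 / e\<^sup>2) ^ (2 * p + 1) * J p e" if "p \<ge> 1" for p
  proof -
    have "continuous_on {x0 - 2 * e..x0 + 2 * e} w"
      using e by (intro continuous_on_subset[OF w]) auto
    moreover have "length (A p) + 2 = 2 * p + 1" using A[OF that] that by simp
    ultimately show ?thesis
      using energy_scaled[OF tf e(1), of x0 w "A p" c] e r by (simp add: h_def [abs_def] J_def)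
  qed
  have "smooth h"
    using smooth_affine[OF f(1), of "1 / e" "- (x0 / e)"] by (simp add: h_def [abs_def] diff_divide_distrib)
  moreover have "vanishes_off {x0 - r..x0 + r} h"
  proof -
    have "(x - x0) / e \<notin> {-1..1}" if "x \<notin> {x0 - r..x0 + r}" for x
      using that e by (auto simp: field_simps)
    then show ?thesis using f(2) by (auto simp: vanishes_off_def h_def)
  qed
  ultimately have "test_fun {x0 - r..x0 + r} h" by (simp add: test_fun_def)
  moreover have "s * energy (A p) c w h > 0 \<and> s * energy (A (p + 1)) c w h \<ge> M * (s * energy (A p) c w h)"
    if p: "p \<in> {1..N}" for p
  proof -
    let ?t = "e * (1 / e\<^sup>2) ^ (2 * p + 1)"
    have t: "?t > 0" using e by simp
    have p1: "p \<ge> 1" "p + 1 \<ge> 1" using p by auto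
    have e1: "s * energy (A p) c w h = ?t * (s * J p e)"
      unfolding en[OF p1(1)] by (simp add: mult_ac)
    have "(1 / e\<^sup>2) ^ (2 * (p + 1) + 1) = (1 / e\<^sup>2) ^ (2 * p + 1) * (1 / e ^ 4)"
      by (simp add: power_add power2_eq_square power4_eq_xxxx)
    then have e2: "s * energy (A (p + 1)) c w h = ?t * ((1 / e ^ 4) * (s * J (p + 1) e))"
      unfolding en[OF p1(2)] by (simp add: mult_ac)
    have "M * (s * J p e) \<le> (1 / e ^ 4) * (s * J (p + 1) e)"
      using J(2)[OF p] e by (simp add: field_simps)
    then have "?t * (M * (s * J p e)) \<le> ?t * ((1 / e ^ 4) * (s * J (p + 1) e))"
      using t by (intro mult_left_mono) auto
    then show ?thesis
      unfolding e1 e2 mult.left_commute[of M ?t] using mult_pos_pos[OF t J(1)[OF p]] by (intro conjI)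
  qed
  ultimately show ?thesis by blast
qed

text \<open>Differential operators do not enlarge supports, so the mixed terms vanish pointwise. The
  condition on \<open>w\<close> provides integrability although phi_K / phi_1 is only controlled
  inside the open interval.\<close>

lemma energy_disjoint:
  assumes u: "test_fun S u" and v: "test_fun T v" and ST: "S \<inter> T = {}" "S \<subseteq> {0<..<1}" "T \<subseteq> {0<..<1}"
    and w: "\<And>R f. test_fun R f \<Longrightarrow> R \<subseteq> {0<..<1} \<Longrightarrow> smooth (\<lambda>x. f x * w x)"
  shows "energy as c w (\<lambda>x. a * u x + b * v x) = a\<^sup>2 * energy as c w u + b\<^sup>2 * energy as c w v"
proof -
  have s: "smooth u" "smooth v" using u v by (auto simp: test_fun_def)
  have int: "((\<lambda>x. foldr opL as (opL c h) x * (opL c h x * w x)) has_integral energy as c w h) {0..1}"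
    if "test_fun R h" "R \<subseteq> {0<..<1}" for h R
  proof -
    have "smooth (foldr opL as (opL c h))" "smooth (\<lambda>x. opL c h x * w x)"
      using that w[OF test_fun_opL] by (auto simp: test_fun_def intro!: smooth_opLs smooth_opL)
    then show ?thesis
      unfolding energy_def by (intro integrable_integral smooth_integrable) (rule smooth_mult)
  qed
  have "foldr opL as (opL c (\<lambda>x. a * u x + b * v x)) x * (opL c (\<lambda>x. a * u x + b * v x) x * w x)
     = a\<^sup>2 * (foldr opL as (opL c u) x * (opL c u x * w x)) + b\<^sup>2 * (foldr opL as (opL c v) x * (opL c v x * w x))" for x
  proof -
    let ?u = "foldr opL as (opL c u) x" and ?v = "foldr opL as (opL c v) x"
    have z: "?u * opL c v x = 0" "?v * opL c u x = 0"
      using test_fun_opLs[OF test_fun_opL[OF u], of as c] test_fun_opLs[OF test_fun_opL[OF v], of as c] test_fun_opL[OF u, of c] test_fun_opL[OF v, of c] ST(1)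
      by (auto simp: test_fun_def vanishes_off_def disjoint_iff)
    have "foldr opL as (opL c (\<lambda>x. a * u x + b * v x)) x * (opL c (\<lambda>x. a * u x + b * v x) x * w x)
      = (a * ?u + b * ?v) * ((a * opL c u x + b * opL c v x) * w x)"
      using s by (simp add: opL_lincomb opLs_lincomb smooth_opL)
    also have "\<dots> = a\<^sup>2 * (?u * (opL c u x * w x)) + b\<^sup>2 * (?v * (opL c v x * w x))
       + a * b * w x * (?u * opL c v x) + a * b * w x * (?v * opL c u x)"
      by (simp add: algebra_simps power2_eq_square)
    finally show ?thesis by (simp only: z mult_zero_right add_0_right)
  qed
  then show ?thesis
    unfolding energy_def[of _ _ _ "\<lambda>x. a * u x + b * v x"]
    using has_integral_add[OF has_integral_mult_right[OF int[OF u ST(2)], of "a\<^sup>2"] has_integral_mult_right[OF int[OF v ST(3)], of "b\<^sup>2"]]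
    by (intro integral_unique) (simp only:)
qed

section \<open>Cancelling the lower forms\<close>

text \<open>\<open>R 1\<close> and \<open>R (-1)\<close> stand for the regions where the weight is
  positive or negative. The induction generalises the sign, the intervals and \<open>M\<close>: both
  signs are needed on smaller intervals, and the growth factor of the dominant summand is fixed only
  after the other summand is known.\<close>

lemma cancel_lower_forms:
  fixes Q :: "nat \<Rightarrow> (real \<Rightarrow> real) \<Rightarrow> real" and R :: "real \<Rightarrow> real set"
  assumes add: "\<And>S T u v p a b. test_fun S u \<Longrightarrow> test_fun T v \<Longrightarrow> S \<inter> T = {} \<Longrightarrow> S \<subseteq> R 1 \<union> R (-1) \<Longrightarrow> T \<subseteq> R 1 \<union> R (-1) \<Longrightarrow>
      Q p (\<lambda>x. a * u x + b * v x) = a\<^sup>2 * Q p u + b\<^sup>2 * Q p v"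
    and base: "\<And>s a b M. s \<in> {1, -1} \<Longrightarrow> a < b \<Longrightarrow> {a..b} \<subseteq> R s \<Longrightarrow>
      \<exists>h. test_fun {a..b} h \<and> (\<forall>p\<in>{1..N}. s * Q p h > 0 \<and> s * Q (p + 1) h \<ge> M * (s * Q p h))"
    and R: "R 1 \<inter> R (-1) = {}"
    and n: "1 \<le> n" "n \<le> N"
    and s: "s \<in> {1, -1}" and ab: "a < b" "{a..b} \<subseteq> R 1" and cd: "c < d" "{c..d} \<subseteq> R (-1)"
  shows "\<exists>h. test_fun ({a..b} \<union> {c..d}) h \<and> (\<forall>p\<in>{1..<n}. Q p h = 0) \<and> s * Q n h > 0 \<and>
    (\<forall>p\<in>{n..N}. s * Q (p + 1) h \<ge> M * (s * Q p h))"
  using n s ab cd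
proof (induction n arbitrary: s a b c d M rule: nat_induct_at_least)
  case base
  show ?case
  proof (cases "s = 1")
    case True
    \<comment> \<open>Inside this case \<open>base\<close> names the premises of the induction, so
      the bump hypothesis is addressed as \<open>assms(2)\<close>.\<close>
    from assms(2)[of 1 a b M] base obtain h where h: "test_fun {a..b} h"
      "\<forall>p\<in>{1..N}. 1 * Q p h > 0 \<and> 1 * Q (p + 1) h \<ge> M * (1 * Q p h)" by auto
    then have "test_fun ({a..b} \<union> {c..d}) h" by (auto simp: test_fun_def vanishes_off_def)
    then show ?thesis using h base True by (intro exI[of _ h]) auto
  next
    case False
    then have s: "s = -1" using base by auto
    from assms(2)[of "-1" c d M] base obtain h where h: "test_fun {c..d} h"
      "\<forall>p\<in>{1..N}. -1 * Q p h > 0 \<and> -1 * Q (p + 1) h \<ge> M * (-1 * Q p h)" by auto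
    then have "test_fun ({a..b} \<union> {c..d}) h" by (auto simp: test_fun_def vanishes_off_def)
    then show ?thesis using h base s by (intro exI[of _ h]) auto
  qed
next
  case (Suc n)
  note ab = Suc.prems(3,4) and cd = Suc.prems(5,6)
  \<comment> \<open>\<open>S\<close> takes the left thirds and \<open>T\<close> the right thirds, so
    the two are disjoint and each meets both sign regions in an interval.\<close>
  define S T where "S = {a..a + (b - a) / 3} \<union> {c..c + (d - c) / 3}"
    and "T = {b - (b - a) / 3..b} \<union> {d - (d - c) / 3..d}"
  have "{a..b} \<inter> {c..d} = {}" using ab cd R by blast
  moreover have "S \<subseteq> {a..b} \<union> {c..d}" "T \<subseteq> {a..b} \<union> {c..d}"
    using ab cd by (auto simp: S_def T_def field_simps)
  moreover have "{a..a + (b - a) / 3} \<inter> {b - (b - a) / 3..b} = {}" "{c..c + (d - c) / 3} \<inter> {d - (d - c) / 3..d} = {}"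
    using ab cd by (auto simp: field_simps)
  moreover have "{a..a + (b - a) / 3} \<subseteq> {a..b}" "{b - (b - a) / 3..b} \<subseteq> {a..b}"
     "{c..c + (d - c) / 3} \<subseteq> {c..d}" "{d - (d - c) / 3..d} \<subseteq> {c..d}"
    using ab cd by (auto simp: field_simps)
  ultimately have sub: "S \<subseteq> {a..b} \<union> {c..d}" "T \<subseteq> {a..b} \<union> {c..d}" and ST: "S \<inter> T = {}"
    and ivls: "{a..a + (b - a) / 3} \<subseteq> R 1" "{b - (b - a) / 3..b} \<subseteq> R 1"
     "{c..c + (d - c) / 3} \<subseteq> R (-1)" "{d - (d - c) / 3..d} \<subseteq> R (-1)"
    using ab cd unfolding S_def T_def by blast+
  have subR: "S \<subseteq> R 1 \<union> R (-1)" "T \<subseteq> R 1 \<union> R (-1)" using sub ab cd by blast+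
  have "n \<le> N" "- s \<in> {1, -1}" using Suc.prems by auto
  \<comment> \<open>The function of opposite sign is fixed first, with the arbitrary growth factor
    1; \<open>u\<close> is then chosen to dominate it at all higher indices.\<close>
  then obtain v where v: "test_fun T v" "\<forall>p\<in>{1..<n}. Q p v = 0" "- s * Q n v > 0"
    using Suc.IH[of "- s" "b - (b - a) / 3" b "d - (d - c) / 3" d 1] ivls ab cd unfolding T_def by auto
  define qv where "qv = - s * Q n v"
  define B where "B = (\<Sum>p\<le>N + 1. \<bar>s * Q p v / qv\<bar>)"
  \<comment> \<open>\<open>B\<close> bounds all normalised values of \<open>v\<close>. The choice
    gives \<open>M' > B\<close>, for the sign of the next form, and
    \<open>M' - M \<ge> B + B * \<bar>M\<bar>\<close>, for the growth condition.\<close>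
  define M' where "M' = 1 + \<bar>M\<bar> + B * (1 + \<bar>M\<bar>)"
  have B: "\<bar>s * Q p v / qv\<bar> \<le> B" if "p \<le> N + 1" for p
    unfolding B_def using that by (intro member_le_sum) auto
  have "B \<ge> 0" unfolding B_def by (intro sum_nonneg) auto
  then have "B * \<bar>M\<bar> \<ge> 0" by simp
  then have M': "M' \<ge> 1" "M' > B" "M' - M \<ge> B + B * \<bar>M\<bar>" "M' - M \<ge> 0"
    using \<open>B \<ge> 0\<close> abs_ge_self[of M] abs_ge_zero[of M] unfolding M'_def distrib_left mult_1_right by linarith+
  obtain u where u: "test_fun S u" "\<forall>p\<in>{1..<n}. Q p u = 0" "s * Q n u > 0"
    "\<forall>p\<in>{n..N}. s * Q (p + 1) u \<ge> M' * (s * Q p u)"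
    using Suc.IH[of s a "a + (b - a) / 3" c "c + (d - c) / 3" M'] \<open>n \<le> N\<close> Suc.prems(2) ivls ab cd
    unfolding S_def by auto
  define qu where "qu = s * Q n u"
  have q: "qu > 0" "qv > 0" using u v by (auto simp: qu_def qv_def)
  \<comment> \<open>The forms are quadratic, so these square roots normalise \<open>s * Q n\<close>
    to 1 on the \<open>u\<close> part and to -1 on the \<open>v\<close> part, and the two
    cancel.\<close>
  define h where "h = (\<lambda>x. sqrt (1 / qu) * u x + sqrt (1 / qv) * v x)"
  have Qh: "Q p h = Q p u / qu + Q p v / qv" for p
    unfolding h_def using add[OF u(1) v(1) ST subR] q by simp
  define x y where "x p = s * Q p u / qu" and "y p = s * Q p v / qv" for p
  have sQh: "s * Q p h = x p + y p" for p
    unfolding Qh x_def y_def by (simp add: algebra_simps)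
  have xn: "x n = 1" "y n = -1" using q by (auto simp: x_def y_def qu_def qv_def divide_simps)
  have xs: "x (p + 1) \<ge> M' * x p" if "p \<in> {n..N}" for p
    using u(4) that q by (auto simp: x_def divide_simps mult_ac)
  have x1: "x p \<ge> 1" if "n \<le> p" "p \<le> N + 1" for p
    using that
  proof (induction p rule: dec_induct)
    case (step p)
    then have "1 * 1 \<le> M' * x p" using M' by (intro mult_mono) auto
    then show ?case using xs[of p] step by simp
  qed (use xn in simp)
  have y: "\<bar>y p\<bar> \<le> B" if "p \<le> N + 1" for p using B[OF that] by (simp add: y_def)
  have "test_fun ({a..b} \<union> {c..d}) h"
  proof -
    have "smooth h" unfolding h_def using u v by (intro smooth_lincomb) (auto simp: test_fun_def)
    moreover have "vanishes_off ({a..b} \<union> {c..d}) h"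
      using u(1) v(1) sub unfolding vanishes_off_def test_fun_def h_def by (metis add_0 mult_zero_right subsetD)
    ultimately show ?thesis by (simp add: test_fun_def closed_Un)
  qed
  moreover have "Q p h = 0" if p: "p \<in> {1..<Suc n}" for p
  proof (cases "p = n")
    case True
    have "s \<noteq> 0" using Suc.prems by auto
    then show ?thesis using sQh[of n] xn True by simp
  next
    case False
    then show ?thesis using p u(2) v(2) by (auto simp: Qh)
  qed
  \<comment> \<open>The \<open>u\<close> part is at least \<open>M'\<close>, which exceeds the bound
    \<open>B\<close> on the \<open>v\<close> part.\<close>
  moreover have "s * Q (Suc n) h > 0"
    using xs[of n] xn y[of "Suc n"] M' \<open>n \<le> N\<close> Suc.prems by (simp add: sQh)
  moreover have "s * Q (p + 1) h \<ge> M * (s * Q p h)" if p: "p \<in> {Suc n..N}" for p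
  proof -
    \<comment> \<open>Since \<open>x p \<ge> 1\<close>, the surplus \<open>(M' - M) * x p\<close>
      absorbs both \<open>M * y p\<close> and a negative \<open>y (p + 1)\<close>.\<close>
    have "(M' - M) * 1 \<le> (M' - M) * x p" using p x1[of p] M' by (intro mult_left_mono) auto
    then have "M * x p + (B + B * \<bar>M\<bar>) \<le> M' * x p" using M' by (simp add: left_diff_distrib)
    moreover have "M * y p \<le> B * \<bar>M\<bar>"
    proof -
      have "\<bar>M\<bar> * \<bar>y p\<bar> \<le> \<bar>M\<bar> * B" using y[of p] p by (intro mult_left_mono) auto
      then show ?thesis using abs_ge_self[of "M * y p"] by (simp add: abs_mult mult.commute)
    qed
    moreover have "M' * x p \<le> x (p + 1)" using xs[of p] p by simp
    moreover have "- B \<le> y (p + 1)" using y[of "p + 1"] p by (auto simp: abs_le_iff)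
    ultimately show ?thesis by (simp add: sQh distrib_left)
  qed
  ultimately show ?case by blast
qed

section \<open>The quantities A^p_K as energies\<close>

definition shifts :: "nat \<Rightarrow> nat \<Rightarrow> real list" where
  "shifts K p = (lam 1 + lam K) / 2 # concat (replicate (p - 1) [lam K, lam 1])"

text \<open>The odd length is what makes the leading part of the form definite up to the sign of the
  weight.\<close>

lemma length_shifts: "p \<ge> 1 \<Longrightarrow> length (shifts K p) = 2 * p - 1"
proof -
  have "length (concat (replicate k [lam K, lam 1])) = 2 * k" for k by (induction k) auto
  then show "p \<ge> 1 \<Longrightarrow> length (shifts K p) = 2 * p - 1" by (simp add: shifts_def)
qed

lemma prod_shifts:
  "(\<Prod>a\<leftarrow>shifts K p. l - a) = (l - (lam 1 + lam K) / 2) * ((l - lam K) * (l - lam 1)) ^ (p - 1)"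
proof -
  have "(\<Prod>a\<leftarrow>concat (replicate k [lam K, lam 1]). l - a) = ((l - lam K) * (l - lam 1)) ^ k" for k
    by (induction k) (auto simp: mult_ac)
  then show ?thesis by (simp add: shifts_def)
qed

lemma quotient_by_phi_1:
  assumes f: "test_fun S f" and S: "S \<subseteq> {0<..<1}" and mu: "mu = (\<lambda>x. f x / phi 1 x)"
  shows "smooth mu" "vanishes_off S mu" "(\<lambda>x. mu x * phi 1 x) = f"
    "test_fun S (\<lambda>x. mu x * phi K x)"
proof -
  show m: "smooth mu" using smooth_divide_phi_1[OF f S] by (simp add: mu)
  show v: "vanishes_off S mu" using f by (simp add: test_fun_def vanishes_off_def mu)
  show "(\<lambda>x. mu x * phi 1 x) = f"
  proof
    fix x
    show "mu x * phi 1 x = f x"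
    proof (cases "x \<in> S")
      case True
      then show ?thesis using S phi_1_pos[of x] by (auto simp: mu)
    next
      case False
      then show ?thesis using f by (simp add: test_fun_def vanishes_off_def mu)
    qed
  qed
  show "test_fun S (\<lambda>x. mu x * phi K x)"
    using m v f by (auto simp: test_fun_def vanishes_off_def intro!: smooth_mult smooth_phi)
qed

text \<open>Here mu phi_1 = f and mu phi_K = g, which is f times the weight, so c_j is a product of
  coefficients of \<open>f\<close> and \<open>g\<close>. Reversing \<open>lam K - lam j\<close>
  cancels the outer sign, the remaining weight is the spectral factor of \<open>shifts K p\<close>,
  and Parseval sums the series.\<close>

lemma AKp_eq_energy:
  assumes h: "test_fun S h" and S: "S \<subseteq> {0<..<1}"
  shows "AKp (\<lambda>x. opL (lam K) h x / phi 1 x) K p = energy (shifts K p) (lam K) (\<lambda>x. phi K x / phi 1 x) h"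
proof -
  define f where "f = opL (lam K) h"
  define mu where "mu = (\<lambda>x. f x / phi 1 x)"
  define g where "g = (\<lambda>x. mu x * phi K x)"
  have f: "test_fun S f" unfolding f_def using h by (rule test_fun_opL)
  note data = quotient_by_phi_1[OF f S mu_def]
  have g: "test_fun S g" unfolding g_def by (rule data)
  have cc: "cc mu K j = ip f (phi j) * ip g (phi j)" for j
    unfolding cc_def data(3) g_def ..
  let ?F = "foldr opL (shifts K p) f"
  let ?t = "\<lambda>i. let j = Suc i in (lam j - (lam 1 + lam K) / 2) * (lam K - lam j) ^ (p - 1) * (lam j - lam 1) ^ (p - 1) * cc mu K j"
  have sq: "(-1) ^ (p - 1) * ((-1) ^ (p - 1) * z) = z" for z :: real
    by (simp flip: power_mult_distrib mult.assoc)
  have t: "?t i = (-1) ^ (p - 1) * (ip ?F (phi (Suc i)) * ip g (phi (Suc i)))" for i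
  proof -
    have "(lam K - lam (Suc i)) ^ (p - 1) = (-1) ^ (p - 1) * (lam (Suc i) - lam K) ^ (p - 1)"
      by (simp flip: power_mult_distrib)
    then show ?thesis
      unfolding ip_opLs_phi[OF f S] prod_shifts cc Let_def power_mult_distrib by (simp only: mult_ac)
  qed
  have "(\<lambda>i. ip ?F (phi (Suc i)) * ip g (phi (Suc i))) sums ip ?F g"
    using parseval[OF test_fun_opLs[OF f] g S S] .
  then have "?t sums ((-1) ^ (p - 1) * ip ?F g)" unfolding t by (rule sums_mult)
  then have "AKp mu K p = ip ?F g" unfolding AKp_def by (simp only: sums_unique[symmetric] sq)
  also have "\<dots> = energy (shifts K p) (lam K) (\<lambda>x. phi K x / phi 1 x) h"
    by (simp add: ip_def energy_def g_def f_def mu_def)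
  finally show ?thesis by (simp only: mu_def f_def)
qed

section \<open>Sign regions of phi_K / phi_1 and construction of mu\<close>

lemma continuous_on_phi_ratio:
  assumes "S \<subseteq> {0<..<1}" shows "continuous_on S (\<lambda>x. phi K x / phi 1 x)"
proof (intro continuous_on_divide smooth_continuous_on smooth_phi ballI)
  fix x assume "x \<in> S"
  then show "phi 1 x \<noteq> 0" using assms phi_1_pos[of x] by auto
qed

lemma phi_sign_left:
  assumes "K > 0" "0 < x" "x < 1 / real K" shows "phi K x > 0"
proof -
  have "real K * x < 1" using assms by (simp add: field_simps)
  then have "real K * pi * x < pi" by (simp add: mult.left_commute mult.assoc)
  then show ?thesis using assms sin_gt_zero[of "real K * pi * x"] by (simp add: phi_def)
qed

lemma phi_sign_right:
  assumes "K > 0" "1 / real K < x" "x < 2 / real K" shows "phi K x < 0"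
proof -
  have "1 < real K * x" "real K * x < 2" using assms by (simp_all add: field_simps)
  then have "pi * 1 < pi * (real K * x)" "pi * (real K * x) < pi * 2" by (simp_all only: mult_less_cancel_left_pos pi_gt_zero)
  then have "pi < real K * pi * x" "real K * pi * x < 2 * pi" by (simp_all add: mult_ac)
  then show ?thesis using sin_lt_zero[of "real K * pi * x"] by (simp add: phi_def mult_pos_neg)
qed

theorem theoremA1:
  fixes K n :: nat
  assumes "K \<ge> 2" and "n \<ge> 1"
  shows "\<exists>mu :: real \<Rightarrow> real. smooth_compact_01 mu \<and> H1 mu K \<and> H2 mu K n"
proof -
  have K: "real K \<ge> 2" "K > 0" using assms by auto
  define w where "w x = phi K x / phi 1 x" for x
  define R where "R s = {x. 0 < x \<and> x < 1 \<and> s * w x > 0}" for s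
  let ?Q = "\<lambda>p. energy (shifts K p) (lam K) w"
  have R01: "R s \<subseteq> {0<..<1}" for s by (auto simp: R_def)
  have wc: "continuous_on X w" if "X \<subseteq> {0<..<1}" for X
    using continuous_on_phi_ratio[OF that, of K] by (simp add: w_def [abs_def])
  \<comment> \<open>These are the middle halves of the first two nodal intervals (0, 1/K) and (1/K,
    2/K) of phi_K; \<open>K \<ge> 2\<close> places both inside (0, 1).\<close>
  define a b c d where "a = 1 / (4 * real K)" and "b = 3 / (4 * real K)"
    and "c = 5 / (4 * real K)" and "d = 7 / (4 * real K)"
  have abcd: "0 < a" "a < b" "b < 1 / real K" "1 / real K < c" "c < d" "d < 2 / real K" "d < 1" "2 / real K \<le> 1"
    using K by (auto simp: a_def b_def c_def d_def field_simps)
  have Rab: "{a..b} \<subseteq> R 1"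
  proof
    fix x assume "x \<in> {a..b}"
    then have "0 < x" "x < 1 / real K" "x < 1" using abcd by auto
    then show "x \<in> R 1" using phi_1_pos[of x] phi_sign_left[OF K(2), of x] by (simp add: R_def w_def)
  qed
  have Rcd: "{c..d} \<subseteq> R (-1)"
  proof
    fix x assume "x \<in> {c..d}"
    then have "0 < x" "1 / real K < x" "x < 2 / real K" "x < 1" using abcd by auto
    then show "x \<in> R (-1)"
      using phi_1_pos[of x] phi_sign_right[OF K(2), of x] by (simp add: R_def w_def divide_neg_pos)
  qed
  \<comment> \<open>Taking N = n suffices, because (H2) involves only the forms up to index
    n.\<close>
  have "\<exists>h. test_fun ({a..b} \<union> {c..d}) h \<and> (\<forall>p\<in>{1..<n}. ?Q p h = 0) \<and> 1 * ?Q n h > 0 \<and>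
    (\<forall>p\<in>{n..n}. 1 * ?Q (p + 1) h \<ge> 1 * (1 * ?Q p h))"
  proof (rule cancel_lower_forms[where Q = ?Q and R = R])
    fix S T u v p \<alpha> \<beta>
    assume "test_fun S u" "test_fun T v" "S \<inter> T = {}" "S \<subseteq> R 1 \<union> R (-1)" "T \<subseteq> R 1 \<union> R (-1)"
    moreover have "smooth (\<lambda>x. f x * w x)" if "test_fun X f" "X \<subseteq> {0<..<1}" for X f
      using smooth_mult[OF smooth_divide_phi_1[OF that] smooth_phi[of K]] by (simp add: w_def)
    ultimately show "?Q p (\<lambda>x. \<alpha> * u x + \<beta> * v x) = \<alpha>\<^sup>2 * ?Q p u + \<beta>\<^sup>2 * ?Q p v"
      using R01 by (intro energy_disjoint) blast+
  next
    fix s \<alpha> \<beta> M :: real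
    assume s: "s \<in> {1, -1}" "\<alpha> < \<beta>" "{\<alpha>..\<beta>} \<subseteq> R s"
    define x0 r where "x0 = (\<alpha> + \<beta>) / 2" and "r = (\<beta> - \<alpha>) / 2"
    have eq: "{x0 - r..x0 + r} = {\<alpha>..\<beta>}" by (simp add: x0_def r_def field_simps)
    have "\<alpha> \<in> R s" "\<beta> \<in> R s" "x0 \<in> R s" using s by (auto simp: x0_def)
    then have "s * w x0 > 0" "r > 0" "0 < x0 - r" "x0 + r < 1"
      using s by (auto simp: R_def x0_def r_def field_simps)
    moreover have "continuous_on {x0 - r..x0 + r} w"
      unfolding eq using s R01 by (intro wc) blast
    ultimately show "\<exists>h. test_fun {\<alpha>..\<beta>} h \<and> (\<forall>p\<in>{1..n}. s * ?Q p h > 0 \<and> s * ?Q (p + 1) h \<ge> M * (s * ?Q p h))"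
      using energy_bump[of "shifts K" s w x0 r n "lam K" M] length_shifts unfolding eq by blast
  next
    show "R 1 \<inter> R (- 1) = {}" by (auto simp: R_def)
  qed (use assms abcd Rab Rcd in auto)
  then obtain h where h: "test_fun ({a..b} \<union> {c..d}) h" "\<forall>p\<in>{1..<n}. ?Q p h = 0" "?Q n h > 0" by auto
  define S where "S = {a..b} \<union> {c..d}"
  have S: "S \<subseteq> {0<..<1}" using Rab Rcd R01 unfolding S_def by blast
  define mu where "mu = (\<lambda>x. opL (lam K) h x / phi 1 x)"
  note hS = h(1)[folded S_def]
  note data = quotient_by_phi_1[OF test_fun_opL[OF hS] S mu_def]
  have A: "AKp mu K p = ?Q p h" for p
    using AKp_eq_energy[OF hS S, of K p] by (simp add: mu_def w_def [abs_def])
  have "smooth_compact_01 mu"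
    unfolding smooth_compact_01_def
  proof
    show "\<forall>k x. (deriv ^^ k) mu differentiable at x" using data(1) by (simp add: smooth_def)
    \<comment> \<open>Compact support is stated with a single interval, so the hull of both pieces
      is taken.\<close>
    have "S \<subseteq> {a..d}" using abcd by (auto simp: S_def)
    then have "\<forall>x. x \<notin> {a..d} \<longrightarrow> mu x = 0" using data(2) by (auto simp: vanishes_off_def)
    then show "\<exists>a b. 0 < a \<and> a \<le> b \<and> b < 1 \<and> (\<forall>x. x \<notin> {a..b} \<longrightarrow> mu x = 0)"
      using abcd by (intro exI[of _ a] exI[of _ d]) auto
  qed
  \<comment> \<open>The K-th coefficient of mu phi_1 = L_{\<lambda>_K} h carries the factor
    \<open>lam K - lam K\<close>.\<close>
  moreover have "H1 mu K"
    unfolding H1_def data(3) ip_opL_phi[OF hS S] by simp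
  moreover have "H2 mu K n"
    unfolding H2_def A
  proof (intro conjI allI impI)
    have "smooth (\<lambda>x. mu x * phi K x)" using data(4) by (simp add: test_fun_def)
    then show "summable (\<lambda>i. real (Suc i) ^ (4 * n) * \<bar>cc mu K (Suc i)\<bar>)"
      unfolding cc_def data(3) by (intro summable_weighted_ip_phi[OF test_fun_opL[OF hS] S])
  qed (use h assms in auto)
  ultimately show ?thesis by blast
qed

end
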